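(* Let $\Bbbk$ be a field, $S=\Bbbk[x_1,\ldots,x_n]$, and let $I$ be a monomial ideal in $S$. The following are equivalent: (a) $\mathcal{F}_{\mathfrak{Bu}(I)}$ is a minimal (free) resolution of $I$. (b) The Scarf complex $\mathfrak{Sc}(I)$ and the Buchberger complex $\mathfrak{Bu}(I)$ coincide.
   Context: $\mathcal{G}(I)$ denotes the set of minimal monomial generators of $I$. For a finite set $F$ of monomials, $\mathbf{m}_F$ denotes the least common multiple of the elements of $F$ (with $\mathbf{m}_\emptyset=1$). For monomials $u=x_1^{u_1}\cdots x_n^{u_n}$ and $v=x_1^{v_1}\cdots x_n^{v_n}$, $u$ properly divides $v$ (written $u\mid_p v$) if $u$ divides $v$, $u_i<v_i$ for all $i$ with $v_i\neq 0$, and $u_i=v_i$ for all $i$ with $v_i=0$. The Buchberger complex $\mathfrak{Bu}(I)$ is the simplicial complex consisting of all subsets $F\subseteq\mathcal{G}(I)$ such that no $u\in\mathcal{G}(I)$ properly divides $\mathbf{m}_F$. The Scarf complex $\mathfrak{Sc}(I)$ is the simplicial complex consisting of all subsets $F\subseteq\mathcal{G}(I)$ such that for every $G\subseteq\mathcal{G}(I)$, $\mathbf{m}_F=\mathbf{m}_G$ implies $F=G$. For a simplicial complex $\Delta$ on vertices in $\mathcal{G}(I)$, each face $F$ is labeled by $\mathbf{m}_F$. The complex $\mathcal{F}_\Delta$ is the $\mathbb{N}^n$-graded simplicial chain complex of $\Delta$ homogenized over $S$: it has a free generator $e_F$ in multidegree $\mathbf{m}_F$ and homological degree $|F|-1$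 for each nonempty face $F$, with differential $\partial(e_F)=\sum_{v\in F}\pm\frac{\mathbf{m}_F}{\mathbf{m}_{F\setminus\{v\}}}e_{F\setminus\{v\}}$ for $|F|\ge 2$ (signs from the usual simplicial boundary map after fixing an order on the vertices), augmented to $I$ by $e_{\{v\}}\mapsto v$.
   Formalization: The ideal I is assumed to be proper: for I = S the monomial 1 properly divides itself, so both complexes are void and coincide, while the zero complex does not resolve S. *)

theory Defs
  imports
    Complex_Main
    "HOL-Library.Poly_Mapping"
    "HOL-Library.Function_Algebras"
begin

section \<open>Monomials and monomial ideals\<close>

text \<open>
  A monomial in the variables \<open>x i\<close>, for \<open>i\<close> in the finite type \<open>'n\<close>, is its exponent vector
  \<open>'n \<Rightarrow> nat\<close>: the product is the pointwise sum, the monomial 1 is \<open>0\<close>, divisibility is the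
  pointwise order \<open>\<le>\<close>, and \<open>v - u\<close> is \<open>v / u\<close> whenever \<open>u \<le> v\<close>.  The polynomial ring over \<open>'k\<close>
  is the monoid algebra \<open>('n \<Rightarrow> nat) \<Rightarrow>\<^sub>0 'k\<close>, with convolution as multiplication.
\<close>

type_synonym 'n mon = "'n \<Rightarrow> nat"
type_synonym ('n, 'k) mpol = "'n mon \<Rightarrow>\<^sub>0 'k"

definition mon_poly :: "'n mon \<Rightarrow> ('n, 'k::comm_ring_1) mpol" where
  "mon_poly u = Poly_Mapping.single u 1"

definition var :: "'n \<Rightarrow> ('n, 'k::comm_ring_1) mpol" where
  "var i = mon_poly (0(i := 1))"

definition ideal_gen :: "'r::comm_ring_1 set \<Rightarrow> 'r set" where
  "ideal_gen A = module.span (*) A"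

definition monomial_ideal :: "('n, 'k::comm_ring_1) mpol set \<Rightarrow> bool" where
  "monomial_ideal I \<longleftrightarrow> (\<exists>A. I = ideal_gen (mon_poly ` A))"

text \<open>
  The monomials of \<open>I\<close> that are minimal under divisibility.  For a monomial ideal this is the
  least set of monomials generating \<open>I\<close>; see \<open>ideal_gen_min_gens\<close> and \<open>min_gens_least\<close> below.
  It is finite by Dickson's lemma.
\<close>
definition min_gens :: "('n, 'k::comm_ring_1) mpol set \<Rightarrow> 'n mon set" where
  "min_gens I = {u. mon_poly u \<in> I \<and> (\<forall>v. mon_poly v \<in> I \<longrightarrow> v \<le> u \<longrightarrow> v = u)}"

definition mlcm :: "'n mon set \<Rightarrow> 'n mon" where
  "mlcm F = (\<lambda>i. Max (insert 0 ((\<lambda>u. u i) ` F)))"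

text \<open>
  Note that the monomial 1 properly divides itself.  Hence for the unit ideal the Buchberger
  complex below has no faces, not even the vertex 1 or the empty face, and neither has the
  Scarf complex.
\<close>
definition properly_divides :: "'n mon \<Rightarrow> 'n mon \<Rightarrow> bool" where
  "properly_divides u v \<longleftrightarrow>
     u \<le> v \<and> (\<forall>i. v i \<noteq> 0 \<longrightarrow> u i < v i) \<and> (\<forall>i. v i = 0 \<longrightarrow> u i = v i)"

definition buchberger_complex :: "('n, 'k::comm_ring_1) mpol set \<Rightarrow> 'n mon set set" where
  "buchberger_complex I =
     {F. F \<subseteq> min_gens I \<and> \<not> (\<exists>u\<in>min_gens I. properly_divides u (mlcm F))}"

definition scarf_complex :: "('n, 'k::comm_ring_1) mpol set \<Rightarrow> 'n mon set set" where
  "scarf_complex I =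
     {F. F \<subseteq> min_gens I \<and> (\<forall>G. G \<subseteq> min_gens I \<longrightarrow> mlcm F = mlcm G \<longrightarrow> F = G)}"


section \<open>Minimal free resolutions\<close>

text \<open>
  A sequence of modules is given by submodules \<open>C 0, C 1, \<dots>\<close> of one module with scalar
  multiplication \<open>scale\<close>; \<open>d i\<close> is the differential from \<open>C (Suc i)\<close> to \<open>C i\<close>, and \<open>aug\<close> is the
  augmentation from \<open>C 0\<close> to the resolved ideal \<open>I\<close>.
\<close>

definition free_submodule :: "('r::comm_ring_1 \<Rightarrow> 'm::ab_group_add \<Rightarrow> 'm) \<Rightarrow> 'm set \<Rightarrow> bool" where
  "free_submodule scale C \<longleftrightarrow>
     (\<exists>B. \<not> module.dependent scale B \<and> module.span scale B = C)"

definition linear_map_on ::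
  "('r \<Rightarrow> 'm \<Rightarrow> 'm) \<Rightarrow> ('r \<Rightarrow> 'p \<Rightarrow> 'p) \<Rightarrow> 'm::plus set \<Rightarrow> 'p::plus set \<Rightarrow> ('m \<Rightarrow> 'p) \<Rightarrow> bool" where
  "linear_map_on s1 s2 C D f \<longleftrightarrow>
     f ` C \<subseteq> D \<and>
     (\<forall>x\<in>C. \<forall>y\<in>C. f (x + y) = f x + f y) \<and>
     (\<forall>r. \<forall>x\<in>C. f (s1 r x) = s2 r (f x))"

definition free_resolution ::
  "('r::comm_ring_1 \<Rightarrow> 'm::ab_group_add \<Rightarrow> 'm) \<Rightarrow> (nat \<Rightarrow> 'm set) \<Rightarrow> (nat \<Rightarrow> 'm \<Rightarrow> 'm)
     \<Rightarrow> ('m \<Rightarrow> 'r) \<Rightarrow> 'r set \<Rightarrow> bool" where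
  "free_resolution scale C d aug I \<longleftrightarrow>
     module scale \<and>
     (\<forall>i. free_submodule scale (C i)) \<and>
     (\<forall>i. linear_map_on scale scale (C (Suc i)) (C i) (d i)) \<and>
     linear_map_on scale (*) (C 0) I aug \<and>
     aug ` C 0 = I \<and>
     {x \<in> C 0. aug x = 0} = d 0 ` C 1 \<and>
     (\<forall>i. {x \<in> C (Suc i). d i x = 0} = d (Suc i) ` C (Suc (Suc i)))"

definition ideal_times ::
  "('r::comm_ring_1 \<Rightarrow> 'm::ab_group_add \<Rightarrow> 'm) \<Rightarrow> 'r set \<Rightarrow> 'm set \<Rightarrow> 'm set" where
  "ideal_times scale J C = module.span scale {scale a x | a x. a \<in> J \<and> x \<in> C}"

definition irrelevant_ideal :: "('n, 'k::comm_ring_1) mpol set" where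
  "irrelevant_ideal = ideal_gen (range var)"

definition minimal_free_resolution ::
  "(('n, 'k::comm_ring_1) mpol \<Rightarrow> 'm::ab_group_add \<Rightarrow> 'm) \<Rightarrow> (nat \<Rightarrow> 'm set) \<Rightarrow> (nat \<Rightarrow> 'm \<Rightarrow> 'm)
     \<Rightarrow> ('m \<Rightarrow> ('n, 'k) mpol) \<Rightarrow> ('n, 'k) mpol set \<Rightarrow> bool" where
  "minimal_free_resolution scale C d aug I \<longleftrightarrow>
     free_resolution scale C d aug I \<and>
     (\<forall>i. d i ` C (Suc i) \<subseteq> ideal_times scale irrelevant_ideal (C i))"


section \<open>The homogenized chain complex of a labeled simplicial complex\<close>

text \<open>
  Chains are finite formal combinations of faces with polynomial coefficients; the generator
  of a face \<open>F\<close> is \<open>Poly_Mapping.single F 1\<close>.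
\<close>

type_synonym ('n, 'k) chain = "'n mon set \<Rightarrow>\<^sub>0 ('n, 'k) mpol"

definition chain_scale ::
  "('n, 'k::comm_ring_1) mpol \<Rightarrow> ('n, 'k) chain \<Rightarrow> ('n, 'k) chain" where
  "chain_scale p c = Poly_Mapping.map ((*) p) c"

definition face_chains :: "'n mon set set \<Rightarrow> nat \<Rightarrow> ('n, 'k::comm_ring_1) chain set" where
  "face_chains \<Delta> i = {c. Poly_Mapping.keys c \<subseteq> {F \<in> \<Delta>. card F = Suc i}}"

text \<open>
  The relation \<open>r\<close> is a linear order on the vertices.  The sign of \<open>v\<close> in \<open>F\<close> is \<open>(-1)\<close> to the
  number of vertices of \<open>F\<close> strictly before \<open>v\<close>.
\<close>
definition face_boundary ::
  "'n mon rel \<Rightarrow> 'n mon set \<Rightarrow> ('n, 'k::comm_ring_1) chain" where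
  "face_boundary r F =
     (\<Sum>v\<in>F. Poly_Mapping.single (F - {v})
        ((-1) ^ card {w \<in> F. w \<noteq> v \<and> (w, v) \<in> r} * mon_poly (mlcm F - mlcm (F - {v}))))"

definition boundary ::
  "'n mon rel \<Rightarrow> ('n, 'k::comm_ring_1) chain \<Rightarrow> ('n, 'k) chain" where
  "boundary r c =
     (\<Sum>F\<in>Poly_Mapping.keys c. chain_scale (Poly_Mapping.lookup c F) (face_boundary r F))"

definition augmentation :: "('n, 'k::comm_ring_1) chain \<Rightarrow> ('n, 'k) mpol" where
  "augmentation c =
     (\<Sum>F\<in>Poly_Mapping.keys c. Poly_Mapping.lookup c F * mon_poly (the_elem F))"

definition minimal_resolution_by_complex ::
  "'n mon rel \<Rightarrow> 'n mon set set \<Rightarrow> ('n, 'k::comm_ring_1) mpol set \<Rightarrow> bool" where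
  "minimal_resolution_by_complex r \<Delta> I \<longleftrightarrow>
     minimal_free_resolution chain_scale (face_chains \<Delta>) (\<lambda>_. boundary r) augmentation I"


section \<open>Minimal generators generate\<close>

lemma module_mult: "module ((*) :: 'r::comm_ring_1 \<Rightarrow> 'r \<Rightarrow> 'r)"
  by unfold_locales (auto simp: algebra_simps)

lemma mon_le_iff_add: "(a::'n mon) \<le> m \<longleftrightarrow> (\<exists>b. m = b + a)"
proof
  assume "a \<le> m"
  then have "m = (m - a) + a" by (auto simp: le_fun_def fun_eq_iff)
  then show "\<exists>b. m = b + a" by blast
qed (auto simp: le_fun_def)

lemma keys_ideal_gen:
  fixes p :: "('n, 'k::comm_ring_1) mpol"
  assumes "p \<in> ideal_gen (mon_poly ` A)" "m \<in> Poly_Mapping.keys p"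
  shows "\<exists>a\<in>A. a \<le> m"
proof -
  interpret module "(*) :: ('n, 'k) mpol \<Rightarrow> _" by (rule module_mult)
  have "\<forall>m\<in>Poly_Mapping.keys p. \<exists>a\<in>A. a \<le> m"
    using assms(1) unfolding ideal_gen_def
  proof (induction rule: span_induct_alt)
    case base
    then show ?case by simp
  next
    case (step c x y)
    then obtain a where a: "a \<in> A" "x = mon_poly a" by auto
    have "\<exists>a\<in>A. a \<le> m" if m: "m \<in> Poly_Mapping.keys (c * x)" for m
    proof -
      have "Poly_Mapping.keys x \<subseteq> {a}" by (simp add: a mon_poly_def)
      then obtain b where "m = b + a" using m Poly_Mapping.keys_mult[of c x] by blast
      then show ?thesis using a by (auto simp: mon_le_iff_add)
    qed
    then show ?case using step Poly_Mapping.keys_add[of "c * x" y] by blast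
  qed
  then show ?thesis using assms(2) by blast
qed

lemma mon_poly_mem_ideal_gen_iff:
  "(mon_poly m :: ('n, 'k::comm_ring_1) mpol) \<in> ideal_gen (mon_poly ` A) \<longleftrightarrow> (\<exists>a\<in>A. a \<le> m)"
proof
  assume "(mon_poly m :: ('n, 'k) mpol) \<in> ideal_gen (mon_poly ` A)"
  then show "\<exists>a\<in>A. a \<le> m" by (rule keys_ideal_gen) (simp add: mon_poly_def)
next
  interpret module "(*) :: ('n, 'k) mpol \<Rightarrow> _" by (rule module_mult)
  assume "\<exists>a\<in>A. a \<le> m"
  then obtain a b where ab: "a \<in> A" "m = b + a" by (auto simp: mon_le_iff_add)
  then have "(mon_poly m :: ('n, 'k) mpol) = mon_poly b * mon_poly a"
    by (simp add: mon_poly_def mult_single)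
  then show "(mon_poly m :: ('n, 'k) mpol) \<in> ideal_gen (mon_poly ` A)"
    using ab by (auto simp: ideal_gen_def intro: span_scale span_base)
qed

lemma exists_minimal_mon:
  fixes m :: "'n::finite mon"
  assumes "P m"
  shows "\<exists>u\<le>m. P u \<and> (\<forall>v. P v \<longrightarrow> v \<le> u \<longrightarrow> v = u)"
  using assms
proof (induction "\<Sum>i\<in>UNIV. m i" arbitrary: m rule: less_induct)
  case less
  show ?case
  proof (cases "\<exists>v. P v \<and> v \<le> m \<and> v \<noteq> m")
    case True
    then obtain v where v: "P v" "v \<le> m" "v \<noteq> m" by blast
    then have le: "\<forall>i. v i \<le> m i" and "\<exists>i. v i \<noteq> m i" by (auto simp: le_fun_def fun_eq_iff)
    then obtain i where "v i < m i" by (meson le_neq_implies_less)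
    then have "(\<Sum>i\<in>UNIV. v i) < (\<Sum>i\<in>UNIV. m i)"
      using le by (intro sum_strict_mono_ex1) auto
    from less(1)[OF this v(1)] show ?thesis using v(2) by (meson order_trans)
  qed (use less in blast)
qed

lemma ideal_gen_min_gens:
  fixes I :: "('n::finite, 'k::comm_ring_1) mpol set"
  assumes "monomial_ideal I"
  shows "ideal_gen (mon_poly ` min_gens I) = I"
proof -
  interpret module "(*) :: ('n, 'k) mpol \<Rightarrow> _" by (rule module_mult)
  obtain A where I: "I = ideal_gen (mon_poly ` A)" using assms by (auto simp: monomial_ideal_def)
  have sub: "subspace I" by (simp add: I ideal_gen_def)
  have "(mon_poly ` A :: ('n, 'k) mpol set) \<subseteq> ideal_gen (mon_poly ` min_gens I)"
  proof clarify
    fix a assume "a \<in> A"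
    then have "(mon_poly a :: ('n, 'k) mpol) \<in> I" by (auto simp: I mon_poly_mem_ideal_gen_iff)
    from exists_minimal_mon[of "\<lambda>m. mon_poly m \<in> I", OF this]
    obtain u where "u \<le> a" "u \<in> min_gens I" by (auto simp: min_gens_def)
    then show "(mon_poly a :: ('n, 'k) mpol) \<in> ideal_gen (mon_poly ` min_gens I)"
      by (auto simp: mon_poly_mem_ideal_gen_iff)
  qed
  then have "I \<subseteq> ideal_gen (mon_poly ` min_gens I)"
    by (simp add: I ideal_gen_def span_minimal)
  moreover have "ideal_gen (mon_poly ` min_gens I) \<subseteq> I"
    unfolding ideal_gen_def by (rule span_minimal[OF _ sub]) (auto simp: min_gens_def)
  ultimately show ?thesis by blast
qed

lemma min_gens_least:
  fixes I :: "('n, 'k::comm_ring_1) mpol set"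
  assumes "I = ideal_gen (mon_poly ` A)"
  shows "min_gens I \<subseteq> A"
proof
  fix u assume "u \<in> min_gens I"
  then have u: "mon_poly u \<in> I" "\<And>v. mon_poly v \<in> I \<Longrightarrow> v \<le> u \<Longrightarrow> v = u"
    by (auto simp: min_gens_def)
  then obtain a where "a \<in> A" "a \<le> u" by (auto simp: assms mon_poly_mem_ideal_gen_iff)
  moreover have "mon_poly a \<in> I" using \<open>a \<in> A\<close> by (auto simp: assms mon_poly_mem_ideal_gen_iff)
  ultimately show "u \<in> A" using u(2) by blast
qed

end

theory Submission
  imports Defs
begin

text \<open>
  The Buchberger complex of a proper monomial ideal always supports a free resolution of it, so the equivalence
  is a statement about minimality alone.

  To see the resolution, fix a multidegree \<open>m\<close>. In degree \<open>m\<close> the complex is the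
  augmented simplicial chain complex, over the coefficient ring, of the faces whose label divides
  \<open>m\<close> (\<open>strand_boundary\<close>), and exactness can be tested one degree at a time
  (\<open>lift_strands\<close>). All sets of generators dividing \<open>m\<close> form a simplex, and coning off
  at one of its vertices turns every cycle into a boundary. The chain obtained in this way may use sets
  \<open>F\<close> outside the Buchberger complex. For such an \<open>F\<close> choose a generator
  \<open>u\<close>, depending only on \<open>mlcm F\<close>, that properly divides \<open>mlcm F\<close>. Adding
  \<open>u\<close> to \<open>F\<close> or removing it from \<open>F\<close> keeps the label, so these sets are
  matched in pairs \<open>{F - {u}, insert u F}\<close> of equal label; this acyclic matching in the sense of
  discrete Morse theory collapses the simplex onto the Buchberger complex. Concretely,
  \<open>push_off_nonfaces\<close> subtracts boundaries of local cones, those with the largest labels first,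
  until no nonface is left.

  A complex of labeled faces is minimal exactly when no face \<open>F\<close> with at least two vertices has a
  facet \<open>F - {v}\<close> with the same label (\<open>boundary_minimal\<close>,
  \<open>labels_differ_if_minimal\<close>). Faces of the Scarf complex have unique labels, so the resolution is
  minimal if the two complexes agree. The Scarf complex is always contained in the Buchberger complex. If the
  inclusion is strict, there are a Buchberger face \<open>F\<close> and a different set \<open>G\<close> of
  generators with the same label. Membership in the Buchberger complex depends on the label only, so adding a
  vertex of one of the two sets to the other gives a face with a facet of the same label, which minimality
  forbids.
\<close>

section \<open>Simplicial chains on an ordered vertex set\<close>

definition vsign :: "'v rel \<Rightarrow> 'v \<Rightarrow> 'v set \<Rightarrow> 'k::comm_ring_1" where
  "vsign r v F = (-1) ^ card {w \<in> F. w \<noteq> v \<and> (w, v) \<in> r}"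

lemma vsign_insert_self [simp]: "vsign r v (insert v F) = vsign r v F"
proof -
  have "{w \<in> insert v F. w \<noteq> v \<and> (w, v) \<in> r} = {w \<in> F. w \<noteq> v \<and> (w, v) \<in> r}" by auto
  then show ?thesis by (simp add: vsign_def)
qed

lemma vsign_remove_self [simp]: "vsign r v (F - {v}) = vsign r v F"
proof -
  have "{w \<in> F - {v}. w \<noteq> v \<and> (w, v) \<in> r} = {w \<in> F. w \<noteq> v \<and> (w, v) \<in> r}" by auto
  then show ?thesis by (simp add: vsign_def)
qed

lemma vsign_empty [simp]: "vsign r v {} = 1"
  by (simp add: vsign_def)

lemma vsign_square [simp]: "vsign r v F * (vsign r v F * x) = (x :: 'k::comm_ring_1)"
proof -
  have "vsign r v F * vsign r v F = (1 :: 'k)"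
    by (simp add: vsign_def flip: power_mult_distrib)
  then show ?thesis by (simp flip: mult.assoc)
qed

text \<open>
  The terms cancel in pairs, so the coefficients may have characteristic 2, where a sum equal to its own
  negative need not vanish.
\<close>
lemma sum_antisymmetric:
  fixes a :: "'v \<Rightarrow> 'v \<Rightarrow> 'a::ab_group_add"
  assumes "finite A" and "\<And>v w. v \<in> A \<Longrightarrow> w \<in> A \<Longrightarrow> v \<noteq> w \<Longrightarrow> a w v = - a v w"
  shows "(\<Sum>v\<in>A. \<Sum>w\<in>A - {v}. a v w) = 0"
  using assms
proof (induction A rule: finite_induct)
  case (insert x A)
  have IH: "(\<Sum>v\<in>A. \<Sum>w\<in>A - {v}. a v w) = 0"
    by (rule insert.IH) (rule insert.prems, auto)
  have "(\<Sum>w\<in>insert x A - {v}. a v w) = a v x + (\<Sum>w\<in>A - {v}. a v w)" if "v \<in> A" for v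
  proof -
    have "insert x A - {v} = insert x (A - {v})" using insert.hyps(2) that by auto
    then show ?thesis using insert.hyps by simp
  qed
  then have "(\<Sum>v\<in>A. \<Sum>w\<in>insert x A - {v}. a v w) = (\<Sum>v\<in>A. a v x + (\<Sum>w\<in>A - {v}. a v w))"
    by (intro sum.cong) auto
  then have "(\<Sum>v\<in>insert x A. \<Sum>w\<in>insert x A - {v}. a v w)
      = (\<Sum>w\<in>A. a x w) + (\<Sum>v\<in>A. a v x + (\<Sum>w\<in>A - {v}. a v w))"
    using insert.hyps by simp
  also have "(\<Sum>v\<in>A. a v x + (\<Sum>w\<in>A - {v}. a v w)) = (\<Sum>v\<in>A. a v x)"
    using IH by (simp add: sum.distrib)
  also have "\<dots> = (\<Sum>v\<in>A. - a x v)"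
  proof (rule sum.cong)
    fix v assume "v \<in> A"
    then show "a v x = - a x v" using insert.hyps(2) by (intro insert.prems) auto
  qed simp
  finally show ?case by (simp add: sum_negf)
qed simp

locale ordered_vertices =
  fixes V :: "'v set" and r :: "'v rel"
  assumes finite_V: "finite V" and order: "linear_order_on V r"
begin

lemma vsign_insert:
  assumes "v \<notin> G" "v \<noteq> u" "finite G"
  shows "(vsign r u (insert v G) :: 'k::comm_ring_1) =
    (if (v, u) \<in> r then - vsign r u G else vsign r u G)"
proof -
  have "{w \<in> insert v G. w \<noteq> u \<and> (w, u) \<in> r} =
      (if (v, u) \<in> r then insert v {w \<in> G. w \<noteq> u \<and> (w, u) \<in> r}
       else {w \<in> G. w \<noteq> u \<and> (w, u) \<in> r})"
    using assms by auto
  then show ?thesis using assms by (simp add: vsign_def)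
qed

text \<open>
  The two orders in which two vertices can be added to a set give opposite signs. Both \<open>bd_bd\<close> and
  the homotopy formula \<open>bd_cone\<close> reduce to this.
\<close>
lemma vsign_swap:
  assumes "u \<in> V - G" "v \<in> V - G" "u \<noteq> v" "G \<subseteq> V"
  shows "vsign r v G * vsign r u (insert v G) =
    - (vsign r u G * vsign r v (insert u G) :: 'k::comm_ring_1)"
proof -
  have "(u, v) \<in> r \<longleftrightarrow> (v, u) \<notin> r"
    using order assms
    by (auto simp: linear_order_on_def partial_order_on_def total_on_def dest: antisymD)
  moreover have "finite G" using assms finite_V finite_subset by blast
  ultimately show ?thesis using assms by (simp add: vsign_insert)
qed

text \<open>
  Chains are coefficient functions on sets of vertices. The formula is the usual simplicial boundary, read off
  at the face \<open>G\<close>; at \<open>G = {}\<close> it is the augmentation, so that cycles are those of the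
  reduced chain complex.
\<close>
definition bd :: "('v set \<Rightarrow> 'k::comm_ring_1) \<Rightarrow> 'v set \<Rightarrow> 'k" where
  "bd \<phi> G = (\<Sum>v\<in>V - G. vsign r v G * \<phi> (insert v G))"

lemma bd_diff: "bd (\<lambda>F. \<phi> F - \<psi> F) G = bd \<phi> G - bd \<psi> G"
  by (simp add: bd_def sum_subtractf algebra_simps)

lemma bd_nonzero:
  assumes "bd \<phi> G \<noteq> 0"
  obtains v where "v \<in> V - G" "\<phi> (insert v G) \<noteq> 0"
  using assms unfolding bd_def by (metis (no_types, lifting) mult_zero_right sum.neutral)

lemma bd_bd:
  fixes \<phi> :: "'v set \<Rightarrow> 'k::comm_ring_1"
  assumes "G \<subseteq> V"
  shows "bd (bd \<phi>) G = 0"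
proof -
  let ?a = "\<lambda>v w. vsign r v G * vsign r w (insert v G) * \<phi> (insert w (insert v G))"
  have "bd (bd \<phi>) G = (\<Sum>v\<in>V - G. \<Sum>w\<in>V - G - {v}. ?a v w)"
    by (simp add: bd_def sum_distrib_left mult.assoc flip: Diff_insert)
  also have "\<dots> = 0"
  proof (rule sum_antisymmetric)
    fix v w assume "v \<in> V - G" "w \<in> V - G" "v \<noteq> w"
    then have "vsign r w G * vsign r v (insert w G) = - (vsign r v G * vsign r w (insert v G) :: 'k)"
      using assms by (intro vsign_swap)
    then show "?a w v = - ?a v w"
      by (simp only: insert_commute[of v w] mult_minus_left)
  qed (simp add: finite_V)
  finally show ?thesis .
qed

text \<open>
  The chain \<open>\<phi>\<close> coned off at an apex \<open>u F\<close> that may vary with the face, as far as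
  the cone lies in \<open>K\<close>.
\<close>
definition cone :: "'v set set \<Rightarrow> ('v set \<Rightarrow> 'v) \<Rightarrow> ('v set \<Rightarrow> 'k::comm_ring_1) \<Rightarrow> 'v set \<Rightarrow> 'k" where
  "cone K u \<phi> F = (if F \<in> K \<and> u F \<in> F then vsign r (u F) F * \<phi> (F - {u F}) else 0)"

text \<open>
  The contracting homotopy of a cone, made local to a family \<open>K\<close> of sets that is closed under
  adding and removing the apex. It yields the contraction of the full simplex (\<open>K\<close> all sets,
  constant apex) as well as the cancellation of the nonfaces of one rank. If the apex is not in
  \<open>G\<close>, only the term that adds it survives. If it is, the surviving terms are those of the boundary
  of \<open>\<phi>\<close> at \<open>G - {u G}\<close> except for \<open>\<phi> G\<close> itself, each with the
  opposite sign, and the vanishing of that boundary gives the result.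
\<close>
lemma bd_cone:
  fixes \<phi> :: "'v set \<Rightarrow> 'k::comm_ring_1"
  assumes K: "\<And>F. F \<in> K \<Longrightarrow> F \<subseteq> V \<and> u F \<in> V \<and> insert (u F) F \<in> K \<and> F - {u F} \<in> K"
    and const: "\<And>F F'. F \<in> K \<Longrightarrow> F' \<in> K \<Longrightarrow> F \<subseteq> F' \<Longrightarrow> u F' = u F"
    and up: "\<And>F F'. F \<in> K \<Longrightarrow> F \<subseteq> F' \<Longrightarrow> F' \<subseteq> V \<Longrightarrow> \<phi> F' \<noteq> 0 \<Longrightarrow> F' \<in> K"
    and G: "G \<in> K"
    and cycle: "bd \<phi> (G - {u G}) = 0"
  shows "bd (cone K u \<phi>) G = \<phi> G"
proof -
  let ?u = "u G"
  have GV: "G \<subseteq> V" "?u \<in> V" and GK: "insert ?u G \<in> K" "G - {?u} \<in> K" using K[OF G] by auto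
  have uv: "u (insert v G) = ?u" if "insert v G \<in> K" for v using const[OF G that] by blast
  show ?thesis
  proof (cases "?u \<in> G")
    case False
    have "bd (cone K u \<phi>) G = (\<Sum>v\<in>V - G. if v = ?u then \<phi> G else 0)"
      unfolding bd_def
    proof (rule sum.cong)
      fix v assume v: "v \<in> V - G"
      show "vsign r v G * cone K u \<phi> (insert v G) = (if v = ?u then \<phi> G else 0)"
        using uv[of v] GK False v by (auto simp: cone_def)
    qed simp
    then show ?thesis using False GV finite_V by simp
  next
    case True
    define H where "H = G - {?u}"
    have GH: "G = insert ?u H" "?u \<notin> H" using True by (auto simp: H_def)
    have step: "vsign r v G * cone K u \<phi> (insert v G)
        = - vsign r ?u H * (vsign r v H * \<phi> (insert v H))" if v: "v \<in> V - G" for v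
    proof -
      have vu: "v \<noteq> ?u" and ins: "insert v G - {?u} = insert v H" using v True by (auto simp: H_def)
      have "vsign r v G * cone K u \<phi> (insert v G)
          = vsign r v G * vsign r ?u (insert v G) * \<phi> (insert v H)"
      proof (cases "insert v G \<in> K")
        case KG: True
        then show ?thesis using uv[OF KG] True ins by (simp add: cone_def mult.assoc)
      next
        case False
        (* A nonzero value would put insert v H into K, hence also insert v G, which is
           insert v H with the apex added. *)
        have "\<phi> (insert v H) = 0"
        proof (rule ccontr)
          assume "\<phi> (insert v H) \<noteq> 0"
          then have k: "insert v H \<in> K" using up[of H "insert v H"] GK v GV by (auto simp: H_def)
          moreover have "u H = ?u" using const[of H G] GK G by (auto simp: H_def)
          moreover have "u (insert v H) = u H" using const[of H "insert v H"] k GK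
            by (auto simp: H_def)
          ultimately have "insert ?u (insert v H) \<in> K" using K[OF k] by auto
          then show False using False GH(1) by (metis insert_commute)
        qed
        with False show ?thesis by (simp add: cone_def)
      qed
      also have "vsign r v G * vsign r ?u (insert v G) = - (vsign r ?u H * vsign r v H :: 'k)"
      proof -
        have "vsign r ?u (insert v G) = (vsign r ?u (insert v H) :: 'k)"
          using GH by (metis insert_commute vsign_insert_self)
        moreover have "vsign r ?u H * vsign r v G = - (vsign r v H * vsign r ?u (insert v H) :: 'k)"
          using vsign_swap[of v H ?u] GH v GV by auto
        moreover have "finite H" using GH GV finite_subset[OF _ finite_V, of H] by auto
        then have "vsign r ?u (insert v H) = (if (v, ?u) \<in> r then - vsign r ?u H else vsign r ?u H :: 'k)"
          using GH v vu by (intro vsign_insert) auto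
        ultimately show ?thesis
          by (cases "(v, ?u) \<in> r") (simp_all add: mult.commute)
      qed
      finally show ?thesis by (simp add: mult.assoc)
    qed
    have VH: "V - H = insert ?u (V - G)" using GH GV by auto
    have "bd \<phi> H = vsign r ?u H * \<phi> G + (\<Sum>v\<in>V - G. vsign r v H * \<phi> (insert v H))"
      unfolding bd_def VH using True finite_V GH(1) by simp
    then have "(\<Sum>v\<in>V - G. vsign r v H * \<phi> (insert v H)) = - (vsign r ?u H * \<phi> G)"
      using cycle by (simp add: H_def add_eq_0_iff)
    moreover have "bd (cone K u \<phi>) G = - vsign r ?u H * (\<Sum>v\<in>V - G. vsign r v H * \<phi> (insert v H))"
      unfolding bd_def sum_distrib_left by (intro sum.cong step) auto
    ultimately show ?thesis by simp
  qed
qed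

end

section \<open>Pushing chains off the nonfaces\<close>

text \<open>
  An acyclic matching \<open>F - {u F} \<leftrightarrow> insert (u F) F\<close> on an upward closed family
  \<open>B\<close>, the nonfaces of a subcomplex. The rank is monotone and constant on matched pairs, and the
  apex does not change between nested nonfaces of equal rank; this excludes alternating cycles and makes the
  cones over different pairs compatible.
\<close>
locale nonface_matching = ordered_vertices V r for V :: "'v set" and r :: "'v rel" +
  fixes B :: "'v set set" and u :: "'v set \<Rightarrow> 'v" and rank :: "'v set \<Rightarrow> nat"
  assumes B_matched: "F \<in> B \<Longrightarrow> F \<subseteq> V \<and> u F \<in> V \<and> insert (u F) F \<in> B \<and> F - {u F} \<in> B"
    and B_up: "F \<in> B \<Longrightarrow> F \<subseteq> F' \<Longrightarrow> F' \<subseteq> V \<Longrightarrow> F' \<in> B"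
    and rank_mono: "F \<in> B \<Longrightarrow> F \<subseteq> F' \<Longrightarrow> F' \<subseteq> V \<Longrightarrow> rank F \<le> rank F'"
    and rank_u: "F \<in> B \<Longrightarrow> rank (insert (u F) F) = rank F \<and> rank (F - {u F}) = rank F"
    and u_const: "F \<in> B \<Longrightarrow> F \<subseteq> F' \<Longrightarrow> F' \<subseteq> V \<Longrightarrow> rank F' = rank F \<Longrightarrow> u F' = u F"
begin

text \<open>
  Subtracting the boundary of the local cone over the nonfaces of top rank removes these nonfaces from the
  chain: on them \<open>bd_cone\<close> applies, because the boundary of the chain avoids \<open>B\<close> and
  nothing of higher rank occurs in the chain. No nonface of higher rank enters, since all sets in the boundary
  of the cone are contained in nonfaces of top rank. The set \<open>X\<close> bounds the support throughout.
\<close>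
lemma push_off_nonfaces:
  fixes \<psi> :: "'v set \<Rightarrow> 'k::comm_ring_1"
  assumes X: "\<And>F. F \<in> X \<Longrightarrow> F \<subseteq> V" "\<And>F G. F \<in> X \<Longrightarrow> G \<subseteq> F \<Longrightarrow> G \<in> X"
    and X_u: "\<And>F. F \<in> X \<Longrightarrow> F \<in> B \<Longrightarrow> insert (u F) F \<in> X"
    and \<psi>: "\<And>F. \<psi> F \<noteq> 0 \<Longrightarrow> F \<in> X \<and> card F = j"
    and bd_\<psi>: "\<And>F. F \<in> B \<Longrightarrow> bd \<psi> F = 0"
  shows "\<exists>\<psi>'. (\<forall>F. \<psi>' F \<noteq> 0 \<longrightarrow> F \<in> X - B \<and> card F = j) \<and> (\<forall>G\<subseteq>V. bd \<psi>' G = bd \<psi> G)"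
proof -
  have "\<exists>\<psi>'. (\<forall>F. \<psi>' F \<noteq> 0 \<longrightarrow> F \<in> X - B \<and> card F = j) \<and> (\<forall>G\<subseteq>V. bd \<psi>' G = bd \<psi> G)"
    \<comment> \<open>\<open>N\<close> strictly bounds the ranks of the nonfaces in the chain.\<close>
    if "\<And>F. \<psi> F \<noteq> 0 \<Longrightarrow> F \<in> X \<and> card F = j" "\<And>F. F \<in> B \<Longrightarrow> bd \<psi> F = 0"
      "\<And>F. F \<in> B \<Longrightarrow> \<psi> F \<noteq> 0 \<Longrightarrow> rank F < N" for N and \<psi> :: "'v set \<Rightarrow> 'k"
    using that
  proof (induction N arbitrary: \<psi>)
    case 0
    then show ?case by (intro exI[of _ \<psi>]) auto
  next
    case (Suc N)
    define K where "K = {F \<in> B. rank F = N}"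
    define h where "h = cone K u \<psi>"
    define \<psi>' where "\<psi>' = (\<lambda>F. \<psi> F - bd h F)"
    have h: "F \<in> K \<and> F \<in> X \<and> card F = Suc j" if "h F \<noteq> 0" for F
    proof -
      have F: "F \<in> B" "rank F = N" "u F \<in> F" "\<psi> (F - {u F}) \<noteq> 0"
        using that by (auto simp: h_def cone_def K_def split: if_splits)
      have "F - {u F} \<in> B" "F \<subseteq> V" using B_matched[OF F(1)] by auto
      moreover have "u (F - {u F}) = u F"
        by (rule u_const[symmetric]) (use rank_u[OF F(1)] calculation in auto)
      moreover have X: "F - {u F} \<in> X" "card (F - {u F}) = j" using Suc.prems(1) F(4) by auto
      ultimately have "insert (u F) (F - {u F}) \<in> X" using X_u[of "F - {u F}"] by simp
      then have "F \<in> X" using F(3) by (simp add: insert_absorb)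
      moreover have "finite F" using \<open>F \<subseteq> V\<close> finite_V finite_subset by blast
      then have "card F = Suc j" using card.remove[of F "u F"] X(2) F(3) by simp
      ultimately show ?thesis using F by (simp add: K_def)
    qed
    have bd_h: "F \<in> X \<and> card F = j \<and> (F \<in> B \<longrightarrow> rank F \<le> N)" if nz: "bd h F \<noteq> 0" for F
    proof -
      obtain v where v: "v \<in> V - F" "h (insert v F) \<noteq> 0" using bd_nonzero[OF nz] .
      have hv: "insert v F \<in> B" "rank (insert v F) = N" "insert v F \<in> X" "card (insert v F) = Suc j"
        using h[OF v(2)] by (auto simp: K_def)
      then have "F \<in> X" using X(2) by blast
      moreover have "finite F" using X(1)[OF \<open>F \<in> X\<close>] finite_V finite_subset by blast
      ultimately show ?thesis
        using hv v(1) X(1)[OF hv(3)] rank_mono[of F "insert v F"] by auto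
    qed
    have same: "bd \<psi>' G = bd \<psi> G" if "G \<subseteq> V" for G
      using that by (simp add: \<psi>'_def bd_diff bd_bd)
    have "\<exists>\<psi>''. (\<forall>F. \<psi>'' F \<noteq> 0 \<longrightarrow> F \<in> X - B \<and> card F = j) \<and> (\<forall>G\<subseteq>V. bd \<psi>'' G = bd \<psi>' G)"
    proof (rule Suc.IH)
      show "F \<in> X \<and> card F = j" if "\<psi>' F \<noteq> 0" for F
        using that Suc.prems(1)[of F] bd_h[of F] by (cases "bd h F = 0") (auto simp: \<psi>'_def)
      show "bd \<psi>' F = 0" if "F \<in> B" for F using same B_matched[OF that] Suc.prems(2)[OF that] by simp
      show "rank F < N" if F: "F \<in> B" "\<psi>' F \<noteq> 0" for F
      proof -
        have "rank F \<le> N"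
          using F bd_h[of F] Suc.prems(3)[of F] by (cases "bd h F = 0") (auto simp: \<psi>'_def)
        moreover have "rank F \<noteq> N"
        proof
          assume N: "rank F = N"
          have "bd h F = \<psi> F" unfolding h_def
          proof (rule bd_cone)
            show "F \<subseteq> V \<and> u F \<in> V \<and> insert (u F) F \<in> K \<and> F - {u F} \<in> K" if "F \<in> K" for F
              using that B_matched[of F] rank_u[of F] by (auto simp: K_def)
            show "u F' = u F" if "F \<in> K" "F' \<in> K" "F \<subseteq> F'" for F F'
              using that B_matched[of F'] by (intro u_const) (auto simp: K_def)
            show "F' \<in> K" if "F \<in> K" "F \<subseteq> F'" "F' \<subseteq> V" "\<psi> F' \<noteq> 0" for F F'
              using that B_up[of F F'] rank_mono[of F F'] Suc.prems(3)[of F'] by (auto simp: K_def)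
            show "F \<in> K" using F(1) N by (simp add: K_def)
            show "bd \<psi> (F - {u F}) = 0" using B_matched[OF F(1)] Suc.prems(2) by blast
          qed
          then show False using F(2) by (simp add: \<psi>'_def)
        qed
        ultimately show ?thesis by simp
      qed
    qed
    then show ?case using same by simp
  qed
  note step = this
  define N where "N = Suc (Max (insert 0 (rank ` Pow V)))"
  have "rank F < N" if "F \<in> B" for F
  proof -
    have "rank F \<le> Max (insert 0 (rank ` Pow V))" using B_matched[OF that] finite_V by (intro Max_ge) auto
    then show ?thesis by (simp add: N_def)
  qed
  then show ?thesis using step[of \<psi> N] \<psi> bd_\<psi> by blast
qed

text \<open>
  The family \<open>X\<close> is a cone with apex \<open>x\<close>, so the cycle bounds within \<open>X\<close>;
  pushing the bounding chain off \<open>B\<close> leaves its boundary unchanged.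
\<close>
lemma cycle_is_boundary:
  fixes \<phi> :: "'v set \<Rightarrow> 'k::comm_ring_1"
  assumes X: "\<And>F. F \<in> X \<Longrightarrow> F \<subseteq> V" "\<And>F G. F \<in> X \<Longrightarrow> G \<subseteq> F \<Longrightarrow> G \<in> X"
    and X_u: "\<And>F. F \<in> X \<Longrightarrow> F \<in> B \<Longrightarrow> insert (u F) F \<in> X"
    and apex: "x \<in> V" "\<And>F. F \<in> X \<Longrightarrow> insert x F \<in> X"
    and \<phi>: "\<And>F. \<phi> F \<noteq> 0 \<Longrightarrow> F \<in> X - B \<and> card F = j"
    and cycle: "\<And>G. G \<subseteq> V \<Longrightarrow> bd \<phi> G = 0"
  shows "\<exists>\<psi>. (\<forall>F. \<psi> F \<noteq> 0 \<longrightarrow> F \<in> X - B \<and> card F = Suc j) \<and> (\<forall>G\<subseteq>V. bd \<psi> G = \<phi> G)"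
proof -
  define h where "h = cone (Pow V) (\<lambda>_. x) \<phi>"
  have bd_h: "bd h G = \<phi> G" if "G \<subseteq> V" for G
    unfolding h_def
  proof (rule bd_cone)
    show "bd \<phi> (G - {x}) = 0" using that by (intro cycle) auto
  qed (use that apex(1) in auto)
  have h: "F \<in> X \<and> card F = Suc j" if "h F \<noteq> 0" for F
  proof -
    have F: "F \<subseteq> V" "x \<in> F" "\<phi> (F - {x}) \<noteq> 0"
      using that by (auto simp: h_def cone_def split: if_splits)
    then have "insert x (F - {x}) \<in> X" "card (F - {x}) = j"
      using \<phi>[OF F(3)] apex(2)[of "F - {x}"] by auto
    moreover have "card F = Suc (card (F - {x}))"
      by (rule card.remove[OF finite_subset[OF F(1) finite_V] F(2)])
    ultimately show ?thesis using F(2) by (metis insert_Diff)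
  qed
  have "\<exists>\<psi>. (\<forall>F. \<psi> F \<noteq> 0 \<longrightarrow> F \<in> X - B \<and> card F = Suc j) \<and> (\<forall>G\<subseteq>V. bd \<psi> G = bd h G)"
  proof (rule push_off_nonfaces)
    show "bd h F = 0" if "F \<in> B" for F
    proof -
      have "bd h F = \<phi> F" using B_matched[OF that] by (intro bd_h) blast
      also have "\<phi> F = 0" using \<phi>[of F] that by blast
      finally show ?thesis .
    qed
  qed (fact X X_u h)+
  then show ?thesis using bd_h by simp
qed

end

section \<open>Least common multiples and proper divisibility\<close>

lemma mlcm_le_iff:
  assumes "finite F"
  shows "mlcm F \<le> m \<longleftrightarrow> (\<forall>u\<in>F. u \<le> m)"
  using assms by (auto simp: mlcm_def le_fun_def)

lemma mlcm_empty [simp]: "mlcm {} = 0"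
  by (simp add: mlcm_def fun_eq_iff)

lemma mlcm_singleton [simp]: "mlcm {u} = u"
  by (simp add: mlcm_def fun_eq_iff)

lemma mlcm_upper: "finite F \<Longrightarrow> u \<in> F \<Longrightarrow> u \<le> mlcm F"
  using mlcm_le_iff by blast

lemma mlcm_mono: "finite F \<Longrightarrow> G \<subseteq> F \<Longrightarrow> mlcm G \<le> mlcm F"
  by (meson finite_subset mlcm_le_iff mlcm_upper subsetD)

lemma mlcm_insert_absorb: "finite F \<Longrightarrow> u \<le> mlcm F \<Longrightarrow> mlcm (insert u F) = mlcm F"
  by (intro antisym) (auto simp: mlcm_le_iff intro: mlcm_upper mlcm_mono)

lemma properly_divides_le: "properly_divides u v \<Longrightarrow> u \<le> v"
  by (simp add: properly_divides_def)

text \<open>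
  This makes the Buchberger complex closed under subsets.
\<close>
lemma properly_divides_mono:
  assumes "properly_divides u a" "a \<le> b"
  shows "properly_divides u b"
proof -
  have u: "u \<le> a" "\<And>i. a i \<noteq> 0 \<Longrightarrow> u i < a i" "\<And>i. a i = 0 \<Longrightarrow> u i = 0"
    using assms(1) by (auto simp: properly_divides_def)
  have ab: "a i \<le> b i" for i using assms(2) by (simp add: le_fun_def)
  have "u i < b i" if "b i \<noteq> 0" for i
    using u(2)[of i] u(3)[of i] ab[of i] that by (cases "a i = 0") auto
  moreover have "u i = 0" if "b i = 0" for i
    using u(3)[of i] ab[of i] that by simp
  ultimately show ?thesis using u(1) assms(2) by (simp add: properly_divides_def)
qed

lemma properly_divides_self: "properly_divides u u \<longleftrightarrow> u = 0"
  by (auto simp: properly_divides_def fun_eq_iff)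

text \<open>
  A positive exponent of the least common multiple is larger than that of \<open>u\<close>, so it is attained by
  an element other than \<open>u\<close>.
\<close>
lemma mlcm_remove_properly_dividing:
  assumes "finite F" "properly_divides u (mlcm F)"
  shows "mlcm (F - {u}) = mlcm F"
proof (rule antisym)
  show "mlcm F \<le> mlcm (F - {u})"
  proof (rule le_funI)
    fix i
    show "mlcm F i \<le> mlcm (F - {u}) i"
    proof (cases "mlcm F i = 0")
      case False
      have "mlcm F i \<in> insert 0 ((\<lambda>w. w i) ` F)"
        unfolding mlcm_def using assms(1) by (intro Max_in) auto
      then obtain w where w: "w \<in> F" "mlcm F i = w i" using False by auto
      moreover have "u i < mlcm F i" using assms(2) False by (simp add: properly_divides_def)
      ultimately have "w \<in> F - {u}" by auto
      then show ?thesis using mlcm_upper[of "F - {u}" w] assms(1) w(2) by (simp add: le_fun_def)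
    qed simp
  qed
qed (use assms(1) in \<open>auto intro: mlcm_mono\<close>)

section \<open>Finiteness of the set of minimal generators\<close>

text \<open>
  One coordinate at a time: a sequence of natural numbers has a monotone subsequence, and a decreasing one is
  eventually constant, hence increasing after finitely many terms are dropped.
\<close>
lemma incseq_subsequence:
  fixes s :: "nat \<Rightarrow> 'i \<Rightarrow> nat"
  assumes "finite A"
  shows "\<exists>f. strict_mono f \<and> (\<forall>i\<in>A. incseq (\<lambda>n. s (f n) i))"
  using assms
proof (induction A rule: finite_induct)
  case empty
  show ?case using strict_mono_id by blast
next
  case (insert i A)
  then obtain f where f: "strict_mono f" "\<And>k. k \<in> A \<Longrightarrow> incseq (\<lambda>n. s (f n) k)" by blast
  obtain g where g: "strict_mono g" "monoseq (\<lambda>n. s (f (g n)) i)"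
    using seq_monosub[of "\<lambda>n. s (f n) i"] by auto
  have "\<exists>N. incseq (\<lambda>n. s (f (g (n + N))) i)"
  proof (cases "incseq (\<lambda>n. s (f (g n)) i)")
    case True
    then show ?thesis by (intro exI[of _ 0]) simp
  next
    case False
    then have dec: "decseq (\<lambda>n. s (f (g n)) i)" using g(2) by (simp add: monoseq_iff)
    obtain N where N: "\<And>n. s (f (g N)) i \<le> s (f (g n)) i"
      using ex_has_least_nat[of "\<lambda>_. True" 0 "\<lambda>n. s (f (g n)) i"] by blast
    have "(\<lambda>n. s (f (g (n + N))) i) = (\<lambda>_. s (f (g N)) i)"
    proof
      show "s (f (g (n + N))) i = s (f (g N)) i" for n
        by (rule antisym[OF decseqD[OF dec] N]) simp
    qed
    then have "incseq (\<lambda>n. s (f (g (n + N))) i)" by (simp only: incseq_const)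
    then show ?thesis by blast
  qed
  then obtain N where N: "incseq (\<lambda>n. s (f (g (n + N))) i)" by blast
  let ?h = "\<lambda>n. f (g (n + N))"
  have "strict_mono ?h" using f(1) g(1) by (simp add: strict_mono_def)
  moreover have "incseq (\<lambda>n. s (?h n) k)" if "k \<in> insert i A" for k
  proof (cases "k = i")
    case False
    then have "incseq (\<lambda>n. s (f n) k)" using that f(2) by blast
    moreover have "incseq (\<lambda>n. g (n + N))" using g(1) by (simp add: incseq_def strict_mono_less_eq)
    ultimately show ?thesis unfolding incseq_def by blast
  qed (use N in blast)
  ultimately show ?case by blast
qed

text \<open>
  Dickson's lemma: in an infinite set of monomials, a sequence without repetitions has a subsequence that
  increases in all coordinates.
\<close>
lemma finite_antichain:
  fixes S :: "'n::finite mon set"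
  assumes "\<And>u v. u \<in> S \<Longrightarrow> v \<in> S \<Longrightarrow> u \<le> v \<Longrightarrow> u = v"
  shows "finite S"
proof (rule ccontr)
  assume "infinite S"
  then obtain s :: "nat \<Rightarrow> 'n mon" where s: "inj s" "range s \<subseteq> S"
    using infinite_countable_subset by blast
  obtain f where f: "strict_mono f" "\<And>i. incseq (\<lambda>n. s (f n) i)"
    using incseq_subsequence[of UNIV s] by auto
  have "s (f 0) \<le> s (f 1)" using f(2) by (auto simp: le_fun_def incseq_def)
  then have "s (f 0) = s (f 1)" using assms s(2) by blast
  then have "f 0 = f 1" using s(1) by (rule injD[rotated])
  then show False using f(1) by (metis strict_mono_eq zero_neq_one)
qed

lemma finite_min_gens:
  fixes I :: "('n::finite, 'k::comm_ring_1) mpol set"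
  shows "finite (min_gens I)"
  by (rule finite_antichain) (auto simp: min_gens_def)

section \<open>Strands of the homogenized chain complex\<close>

lemma lookup_times_mon_poly:
  fixes p :: "('n, 'k::comm_ring_1) mpol"
  shows "Poly_Mapping.lookup (p * mon_poly a) b =
    (if a \<le> b then Poly_Mapping.lookup p (b - a) else 0)"
proof -
  have inner: "Sum_any (\<lambda>q. Poly_Mapping.lookup (mon_poly a) q when b = l + q) = (1 when b = l + a :: 'k)" for l
  proof -
    have "(\<lambda>q. Poly_Mapping.lookup (mon_poly a) q when b = l + q) = (\<lambda>q. (1 when b = l + a :: 'k) when q = a)"
      by (auto simp: fun_eq_iff mon_poly_def lookup_single when_def)
    then show ?thesis by (simp only: Sum_any_when_equal)
  qed
  have look: "Poly_Mapping.lookup (p * mon_poly a) b = Sum_any (\<lambda>l. Poly_Mapping.lookup p l * (1 when b = l + a))"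
    by (simp only: lookup_mult inner)
  show ?thesis
  proof (cases "a \<le> b")
    case True
    then have le: "a i \<le> b i" for i by (simp add: le_fun_def)
    have "b = l + a \<longleftrightarrow> l = b - a" for l
      using le by (auto simp: fun_eq_iff)
    then have "(\<lambda>l. Poly_Mapping.lookup p l * (1 when b = l + a)) = (\<lambda>l. Poly_Mapping.lookup p l when l = b - a)"
      by (simp add: mult_when)
    then show ?thesis by (simp only: look Sum_any_when_equal True if_True)
  next
    case False
    have "b \<noteq> l + a" for l using False by (auto simp: le_fun_def)
    then show ?thesis using False by (simp add: look)
  qed
qed

lemma lookup_sign_mult:
  fixes p :: "('n, 'k::comm_ring_1) mpol"
  shows "Poly_Mapping.lookup (vsign r v F * p) a = vsign r v F * Poly_Mapping.lookup p a"
proof -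
  have "Poly_Mapping.lookup ((-1) ^ n * p) a = (-1) ^ n * Poly_Mapping.lookup p a" for n
    by (induction n) auto
  then show ?thesis by (simp add: vsign_def)
qed

lemma lookup_chain_scale [simp]:
  "Poly_Mapping.lookup (chain_scale p c) F = p * Poly_Mapping.lookup c F"
  by (simp add: chain_scale_def Poly_Mapping.map.rep_eq when_def)

lemma chain_scale_single [simp]:
  "chain_scale p (Poly_Mapping.single F q) = Poly_Mapping.single F (p * q)"
  by (rule poly_mapping_eqI) (simp add: lookup_single when_def)

lemma module_chain_scale: "module chain_scale"
  by unfold_locales (auto intro!: poly_mapping_eqI simp: lookup_add algebra_simps)

lemma face_boundary_alt:
  "face_boundary r F = (\<Sum>v\<in>F. Poly_Mapping.single (F - {v})
     (vsign r v F * mon_poly (mlcm F - mlcm (F - {v}))))"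
  by (simp add: face_boundary_def vsign_def)

lemma lookup_boundary:
  fixes c :: "('n, 'k::comm_ring_1) chain"
  assumes V: "finite V" and c: "Poly_Mapping.keys c \<subseteq> Pow V"
  shows "Poly_Mapping.lookup (boundary r c) G =
    (\<Sum>v\<in>V - G. vsign r v G * (Poly_Mapping.lookup c (insert v G) * mon_poly (mlcm (insert v G) - mlcm G)))"
proof -
  let ?g = "\<lambda>F v. Poly_Mapping.lookup c F * (vsign r v F * mon_poly (mlcm F - mlcm G))"
  have "Poly_Mapping.lookup (boundary r c) G =
      (\<Sum>F\<in>Poly_Mapping.keys c. \<Sum>v\<in>F. if F - {v} = G then ?g F v else 0)"
    by (auto simp: boundary_def face_boundary_alt lookup_sum lookup_single sum_distrib_left when_def
        intro!: sum.cong)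
  also have "\<dots> = (\<Sum>F\<in>Pow V. \<Sum>v\<in>V. if v \<in> F \<and> F - {v} = G then ?g F v else 0)"
  proof (rule sum.mono_neutral_cong_left)
    show "(\<Sum>v\<in>F. if F - {v} = G then ?g F v else 0)
        = (\<Sum>v\<in>V. if v \<in> F \<and> F - {v} = G then ?g F v else 0)" if "F \<in> Poly_Mapping.keys c" for F
      using that c V by (intro sum.mono_neutral_cong_left) auto
  qed (use V c in \<open>auto simp: in_keys_iff intro!: sum.neutral\<close>)
  also have "\<dots> = (\<Sum>v\<in>V. \<Sum>F\<in>Pow V. if F = insert v G then if v \<notin> G then ?g (insert v G) v else 0 else 0)"
    by (subst sum.swap) (intro sum.cong, auto)
  also have "\<dots> = (\<Sum>v\<in>V. if v \<notin> G then ?g (insert v G) v else 0)"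
  proof (rule sum.cong)
    fix v
    show "(\<Sum>F\<in>Pow V. if F = insert v G then if v \<notin> G then ?g (insert v G) v else 0 else 0)
        = (if v \<notin> G then ?g (insert v G) v else 0)"
    proof (cases "insert v G \<in> Pow V")
      case True
      then show ?thesis using V by (subst sum.delta) auto
    next
      case False
      then have "Poly_Mapping.lookup c (insert v G) = 0" using c by (auto simp: in_keys_iff)
      then show ?thesis by (simp cong: if_cong)
    qed
  qed simp
  also have "\<dots> = (\<Sum>v\<in>V - G. vsign r v G * (Poly_Mapping.lookup c (insert v G) * mon_poly (mlcm (insert v G) - mlcm G)))"
    using V by (intro sum.mono_neutral_cong_right) (auto simp: mult_ac)
  finally show ?thesis .
qed

text \<open>
  The component of \<open>c\<close> in multidegree \<open>m\<close>: since the generator of \<open>F\<close> has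
  degree \<open>mlcm F\<close>, its coefficient contributes the monomial \<open>m - mlcm F\<close> to this
  degree.
\<close>
definition strand :: "'n mon \<Rightarrow> ('n, 'k::comm_ring_1) chain \<Rightarrow> 'n mon set \<Rightarrow> 'k" where
  "strand m c F = (if mlcm F \<le> m then Poly_Mapping.lookup (Poly_Mapping.lookup c F) (m - mlcm F) else 0)"

lemma lookup_via_strand:
  "Poly_Mapping.lookup (Poly_Mapping.lookup c F) a = strand (a + mlcm F) c F"
proof -
  have "mlcm F \<le> a + mlcm F" "a + mlcm F - mlcm F = a" by (auto simp: le_fun_def fun_eq_iff)
  then show ?thesis by (simp add: strand_def)
qed

lemma strand_eqI: "(\<And>m F. strand m c F = strand m c' F) \<Longrightarrow> c = c'"
  by (intro poly_mapping_eqI) (simp add: lookup_via_strand)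

lemma strand_nonzero: "strand m c F \<noteq> 0 \<Longrightarrow> F \<in> Poly_Mapping.keys c \<and> mlcm F \<le> m"
  by (auto simp: strand_def in_keys_iff split: if_splits)

lemma keys_eq_strand: "F \<in> Poly_Mapping.keys c \<longleftrightarrow> (\<exists>m. strand m c F \<noteq> 0)"
proof
  assume "F \<in> Poly_Mapping.keys c"
  then obtain a where "Poly_Mapping.lookup (Poly_Mapping.lookup c F) a \<noteq> 0"
    by (metis in_keys_iff lookup_zero poly_mapping_eqI)
  then show "\<exists>m. strand m c F \<noteq> 0" by (auto simp: lookup_via_strand)
qed (use strand_nonzero in blast)

lemma strand_zero [simp]: "strand m 0 F = 0"
  by (simp add: strand_def)

lemma strand_sum: "strand m (\<Sum>x\<in>A. c x) F = (\<Sum>x\<in>A. strand m (c x) F)"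
  by (simp add: strand_def lookup_sum)

lemma strand_single:
  assumes "mlcm F \<le> m"
  shows "strand m' (Poly_Mapping.single F (Poly_Mapping.single (m - mlcm F) x)) F'
    = (if m' = m \<and> F' = F then x else 0)"
proof -
  have "m' = m" if "mlcm F \<le> m'" "m' - mlcm F = m - mlcm F"
  proof
    fix i
    have "m' i - mlcm F i = m i - mlcm F i" using fun_cong[OF that(2), of i] by simp
    moreover have "mlcm F i \<le> m' i" "mlcm F i \<le> m i" using that(1) assms by (auto simp: le_fun_def)
    ultimately show "m' i = m i" by linarith
  qed
  then show ?thesis using assms by (auto simp: strand_def lookup_single when_def)
qed

lemma finite_strands: "finite {m. \<exists>F. strand m c F \<noteq> 0}"
proof (rule finite_subset)
  let ?S = "\<Union>F\<in>Poly_Mapping.keys c. (\<lambda>a. a + mlcm F) ` Poly_Mapping.keys (Poly_Mapping.lookup c F)"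
  show "finite ?S" by simp
  show "{m. \<exists>F. strand m c F \<noteq> 0} \<subseteq> ?S"
  proof clarify
    fix m F assume nz: "strand m c F \<noteq> 0"
    then have F: "F \<in> Poly_Mapping.keys c" "mlcm F \<le> m" using strand_nonzero by blast+
    then have "m = (m - mlcm F) + mlcm F" by (auto simp: le_fun_def fun_eq_iff)
    moreover have "m - mlcm F \<in> Poly_Mapping.keys (Poly_Mapping.lookup c F)"
      using nz F by (auto simp: strand_def in_keys_iff)
    ultimately show "m \<in> ?S" using F by blast
  qed
qed

text \<open>
  Chains are reassembled from solutions found degree by degree.
\<close>
lemma chain_of_strands:
  fixes \<psi> :: "'n mon \<Rightarrow> 'n mon set \<Rightarrow> 'k::comm_ring_1"
  assumes fin: "finite {(m, F). \<psi> m F \<noteq> 0}"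
    and le: "\<And>m F. \<psi> m F \<noteq> 0 \<Longrightarrow> mlcm F \<le> m"
  obtains c where "\<And>m. strand m c = \<psi> m"
proof
  let ?S = "{(m, F). \<psi> m F \<noteq> 0}"
  let ?c = "\<Sum>(m, F)\<in>?S. Poly_Mapping.single F (Poly_Mapping.single (m - mlcm F) (\<psi> m F))"
  fix m
  show "strand m ?c = \<psi> m"
  proof
    fix F
    have "strand m ?c F = (\<Sum>x\<in>?S. if x = (m, F) then \<psi> m F else 0)"
      unfolding strand_sum by (intro sum.cong) (auto simp: strand_single le split: if_splits)
    also have "\<dots> = \<psi> m F" using fin by auto
    finally show "strand m ?c F = \<psi> m F" .
  qed
qed

text \<open>
  The monomial factors in the homogenized boundary shift the coefficient of \<open>insert v G\<close> from
  \<open>m - mlcm (insert v G)\<close> to \<open>m - mlcm G\<close>, so in each degree the plain simplicial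
  boundary remains.
\<close>
lemma strand_boundary:
  fixes c :: "('n, 'k::comm_ring_1) chain"
  assumes "ordered_vertices V r" and c: "Poly_Mapping.keys c \<subseteq> Pow V"
  shows "strand m (boundary r c) = ordered_vertices.bd V r (strand m c)"
proof
  interpret ordered_vertices V r by fact
  fix G
  show "strand m (boundary r c) G = bd (strand m c) G"
  proof (cases "G \<subseteq> V")
    case False
    then have 0: "Poly_Mapping.lookup c (insert v G) = 0" for v using c by (auto simp: in_keys_iff)
    have "Poly_Mapping.lookup (boundary r c) G = 0" by (simp add: lookup_boundary[OF finite_V c] 0)
    then show ?thesis by (simp add: strand_def bd_def 0 cong: if_cong)
  next
    case True
    then have fin: "finite G" using finite_V finite_subset by blast
    have ins: "mlcm G \<le> mlcm (insert v G)" for v using fin by (intro mlcm_mono) auto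
    show ?thesis
    proof (cases "mlcm G \<le> m")
      case False
      then have "\<not> mlcm (insert v G) \<le> m" for v using ins order_trans by blast
      then show ?thesis using False by (simp add: strand_def bd_def)
    next
      case True
      have iff: "mlcm (insert v G) - mlcm G \<le> m - mlcm G \<longleftrightarrow> mlcm (insert v G) \<le> m" for v
        using ins[of v] True unfolding le_fun_def fun_diff_def
        by (meson diff_le_mono eq_imp_le le_diff_iff)
      have diff: "m - mlcm G - (mlcm (insert v G) - mlcm G) = m - mlcm (insert v G)" for v
        using ins[of v] by (auto simp: le_fun_def fun_eq_iff)
      show ?thesis
        using True unfolding strand_def bd_def lookup_boundary[OF finite_V c]
        by (auto simp: lookup_sum lookup_sign_mult lookup_times_mon_poly iff diff intro!: sum.cong)
    qed
  qed
qed

lemma augmentation_eq: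
  fixes c :: "('n, 'k::comm_ring_1) chain"
  assumes V: "finite V" and c: "Poly_Mapping.keys c \<subseteq> {F. F \<subseteq> V \<and> card F = 1}"
  shows "augmentation c = (\<Sum>v\<in>V. Poly_Mapping.lookup c {v} * mon_poly v)"
proof -
  have "Poly_Mapping.keys c \<subseteq> (\<lambda>v. {v}) ` V"
  proof
    fix F assume "F \<in> Poly_Mapping.keys c"
    then have "F \<subseteq> V" "card F = 1" using c by auto
    then show "F \<in> (\<lambda>v. {v}) ` V" by (metis card_1_singletonE imageI insert_subset)
  qed
  then have "augmentation c = (\<Sum>F\<in>(\<lambda>v. {v}) ` V. Poly_Mapping.lookup c F * mon_poly (the_elem F))"
    unfolding augmentation_def
    using V by (intro sum.mono_neutral_left) (auto simp: in_keys_iff)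
  also have "\<dots> = (\<Sum>v\<in>V. Poly_Mapping.lookup c {v} * mon_poly v)"
    by (subst sum.reindex) (auto simp: inj_on_def)
  finally show ?thesis .
qed

text \<open>
  Exactness at the chains on vertices thus becomes exactness of the reduced simplicial complex in dimension 0,
  and needs no separate treatment.
\<close>
lemma lookup_augmentation:
  fixes c :: "('n, 'k::comm_ring_1) chain"
  assumes "ordered_vertices V r" and c: "Poly_Mapping.keys c \<subseteq> {F. F \<subseteq> V \<and> card F = 1}"
  shows "Poly_Mapping.lookup (augmentation c) m = ordered_vertices.bd V r (strand m c) {}"
proof -
  interpret ordered_vertices V r by fact
  show ?thesis
    by (auto simp: augmentation_eq[OF finite_V c] lookup_sum lookup_times_mon_poly bd_def strand_def
        intro!: sum.cong)
qed

section \<open>Labeled complexes that support a resolution\<close>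

lemma face_chains_lookup:
  "c \<in> face_chains \<Delta> i \<Longrightarrow> Poly_Mapping.lookup c F \<noteq> 0 \<Longrightarrow> F \<in> \<Delta> \<and> card F = Suc i"
  by (auto simp: face_chains_def in_keys_iff)

lemma face_chainsI:
  "(\<And>F. Poly_Mapping.lookup c F \<noteq> 0 \<Longrightarrow> F \<in> \<Delta> \<and> card F = Suc i) \<Longrightarrow> c \<in> face_chains \<Delta> i"
  by (auto simp: face_chains_def in_keys_iff)

lemma chain_expansion:
  fixes c :: "('n, 'k::comm_ring_1) chain"
  shows "c = (\<Sum>F\<in>Poly_Mapping.keys c. chain_scale (Poly_Mapping.lookup c F) (Poly_Mapping.single F 1))"
  by (rule poly_mapping_eqI)
    (simp add: lookup_sum lookup_single when_def in_keys_iff)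

lemma subspace_face_chains:
  "module.subspace chain_scale (face_chains \<Delta> i :: ('n, 'k::comm_ring_1) chain set)"
proof -
  interpret module "chain_scale :: ('n, 'k) mpol \<Rightarrow> _" by (rule module_chain_scale)
  show ?thesis
  proof (rule subspaceI)
    fix c d :: "('n, 'k) chain" and p
    assume c: "c \<in> face_chains \<Delta> i"
    show "chain_scale p c \<in> face_chains \<Delta> i"
      by (rule face_chainsI) (rule face_chains_lookup[OF c], auto)
    assume d: "d \<in> face_chains \<Delta> i"
    show "c + d \<in> face_chains \<Delta> i"
    proof (rule face_chainsI)
      fix F assume "Poly_Mapping.lookup (c + d) F \<noteq> 0"
      then have "Poly_Mapping.lookup c F \<noteq> 0 \<or> Poly_Mapping.lookup d F \<noteq> 0"
        by (auto simp: lookup_add)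
      then show "F \<in> \<Delta> \<and> card F = Suc i" using face_chains_lookup[OF c] face_chains_lookup[OF d] by blast
    qed
  qed (simp add: face_chains_def)
qed

lemma free_submodule_face_chains:
  "free_submodule chain_scale (face_chains \<Delta> i :: ('n, 'k::comm_ring_1) chain set)"
proof -
  interpret module "chain_scale :: ('n, 'k) mpol \<Rightarrow> _" by (rule module_chain_scale)
  let ?e = "\<lambda>F. Poly_Mapping.single F 1 :: ('n, 'k) chain"
  let ?B = "?e ` {F \<in> \<Delta>. card F = Suc i}"
  have "\<not> dependent ?B"
  proof
    assume "dependent ?B"
    then obtain T a where T: "finite T" "T \<subseteq> ?B" "(\<Sum>x\<in>T. chain_scale (a x) x) = 0" "\<exists>x\<in>T. a x \<noteq> 0"
      unfolding dependent_explicit by blast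
    then obtain F where F: "?e F \<in> T" "a (?e F) \<noteq> 0" by auto
    have "Poly_Mapping.lookup (\<Sum>x\<in>T. chain_scale (a x) x) F = (\<Sum>x\<in>T. if x = ?e F then a (?e F) else 0)"
      unfolding lookup_sum
    proof (rule sum.cong)
      fix x assume "x \<in> T"
      then obtain F' where x: "x = ?e F'" using T(2) by blast
      have "x = ?e F \<longleftrightarrow> F' = F"
        unfolding x by (metis lookup_single_eq lookup_single_not_eq one_neq_zero)
      then show "Poly_Mapping.lookup (chain_scale (a x) x) F = (if x = ?e F then a (?e F) else 0)"
        by (auto simp: x lookup_single_not_eq)
    qed simp
    also have "\<dots> = a (?e F)" using T(1) F(1) by simp
    finally show False using T(3) F(2) by simp
  qed
  moreover have "span ?B = face_chains \<Delta> i"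
  proof (rule antisym)
    show "span ?B \<subseteq> face_chains \<Delta> i"
      by (rule span_minimal[OF _ subspace_face_chains])
        (auto intro!: face_chainsI simp: lookup_single when_def split: if_splits)
    show "face_chains \<Delta> i \<subseteq> span ?B"
    proof
      fix c :: "('n, 'k) chain" assume "c \<in> face_chains \<Delta> i"
      then have "(\<Sum>F\<in>Poly_Mapping.keys c. chain_scale (Poly_Mapping.lookup c F) (?e F)) \<in> span ?B"
        unfolding face_chains_def by (intro span_sum span_scale span_base) blast
      then show "c \<in> span ?B" by (simp only: chain_expansion[symmetric])
    qed
  qed
  ultimately show ?thesis unfolding free_submodule_def by blast
qed

locale labeled_complex = ordered_vertices V r for V :: "'n mon set" and r :: "'n mon rel" +
  fixes \<Delta> :: "'n mon set set"
  assumes faces: "F \<in> \<Delta> \<Longrightarrow> F \<subseteq> V"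
    and down: "F \<in> \<Delta> \<Longrightarrow> G \<subseteq> F \<Longrightarrow> G \<in> \<Delta>"
begin

lemma keys_face_chains: "c \<in> face_chains \<Delta> i \<Longrightarrow> Poly_Mapping.keys c \<subseteq> Pow V"
  using faces by (auto simp: face_chains_def)

lemma boundary_linear:
  "linear_map_on chain_scale chain_scale (face_chains \<Delta> (Suc i))
    (face_chains \<Delta> i :: ('n, 'k::comm_ring_1) chain set) (boundary r)"
  unfolding linear_map_on_def
proof (intro conjI ballI allI image_subsetI)
  fix c :: "('n, 'k) chain" assume c: "c \<in> face_chains \<Delta> (Suc i)"
  show "boundary r c \<in> face_chains \<Delta> i"
  proof (rule face_chainsI)
    fix G assume "Poly_Mapping.lookup (boundary r c) G \<noteq> 0"
    then have "\<not> (\<forall>v\<in>V - G. Poly_Mapping.lookup c (insert v G) = 0)"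
      unfolding lookup_boundary[OF finite_V keys_face_chains[OF c]]
      by (rule contrapos_nn) (auto intro!: sum.neutral)
    then obtain v where v: "v \<in> V - G" "Poly_Mapping.lookup c (insert v G) \<noteq> 0" by blast
    have ins: "insert v G \<in> \<Delta>" "card (insert v G) = Suc (Suc i)"
      using face_chains_lookup[OF c v(2)] by auto
    have "finite G" using faces[OF ins(1)] finite_V finite_subset by auto
    then have "card G = Suc i" using ins(2) v(1) by simp
    moreover have "G \<in> \<Delta>" using down[OF ins(1)] by blast
    ultimately show "G \<in> \<Delta> \<and> card G = Suc i" by blast
  qed
next
  fix c d :: "('n, 'k) chain" assume cd: "c \<in> face_chains \<Delta> (Suc i)" "d \<in> face_chains \<Delta> (Suc i)"
  then have sum: "c + d \<in> face_chains \<Delta> (Suc i)"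
    by (rule module.subspace_add[OF module_chain_scale subspace_face_chains])
  note look = lookup_boundary[OF finite_V keys_face_chains, of _ "Suc i"]
  show "boundary r (c + d) = boundary r c + boundary r d"
    by (rule poly_mapping_eqI)
      (simp only: look[OF sum] look[OF cd(1)] look[OF cd(2)] lookup_add distrib_left distrib_right
        sum.distrib)
next
  fix p and c :: "('n, 'k) chain" assume c: "c \<in> face_chains \<Delta> (Suc i)"
  then have pc: "chain_scale p c \<in> face_chains \<Delta> (Suc i)"
    by (rule module.subspace_scale[OF module_chain_scale subspace_face_chains])
  note look = lookup_boundary[OF finite_V keys_face_chains, of _ "Suc i"]
  show "boundary r (chain_scale p c) = chain_scale p (boundary r c)"
    by (rule poly_mapping_eqI)
      (simp only: look[OF pc] look[OF c] lookup_chain_scale sum_distrib_left mult_ac)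
qed

lemma boundary_mem:
  fixes c :: "('n, 'k::comm_ring_1) chain"
  shows "c \<in> face_chains \<Delta> (Suc i) \<Longrightarrow> boundary r c \<in> face_chains \<Delta> i"
  using boundary_linear[where ?'k = 'k, of i] unfolding linear_map_on_def by blast

lemma augmentation_chain:
  assumes "c \<in> face_chains \<Delta> 0"
  shows "augmentation c = (\<Sum>v\<in>V. Poly_Mapping.lookup c {v} * mon_poly v)"
  using assms faces by (intro augmentation_eq finite_V) (auto simp: face_chains_def)

lemma augmentation_linear:
  "linear_map_on chain_scale (*) (face_chains \<Delta> 0 :: ('n, 'k::comm_ring_1) chain set)
    (ideal_gen (mon_poly ` V)) augmentation"
  unfolding linear_map_on_def
proof (intro conjI ballI allI image_subsetI)
  interpret R: module "(*) :: ('n, 'k) mpol \<Rightarrow> _" by (rule module_mult)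
  fix c :: "('n, 'k) chain" assume c: "c \<in> face_chains \<Delta> 0"
  show "augmentation c \<in> ideal_gen (mon_poly ` V)"
    unfolding augmentation_chain[OF c] ideal_gen_def
    by (intro R.span_sum R.span_scale R.span_base imageI)
next
  fix c d :: "('n, 'k) chain" assume cd: "c \<in> face_chains \<Delta> 0" "d \<in> face_chains \<Delta> 0"
  then have sum: "c + d \<in> face_chains \<Delta> 0"
    by (rule module.subspace_add[OF module_chain_scale subspace_face_chains])
  show "augmentation (c + d) = augmentation c + augmentation d"
    by (simp only: augmentation_chain[OF cd(1)] augmentation_chain[OF cd(2)] augmentation_chain[OF sum]
        lookup_add distrib_right sum.distrib)
next
  fix p and c :: "('n, 'k) chain" assume c: "c \<in> face_chains \<Delta> 0"
  then have pc: "chain_scale p c \<in> face_chains \<Delta> 0"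
    by (rule module.subspace_scale[OF module_chain_scale subspace_face_chains])
  show "augmentation (chain_scale p c) = p * augmentation c"
    by (simp only: augmentation_chain[OF c] augmentation_chain[OF pc] lookup_chain_scale
        sum_distrib_left mult_ac)
qed

lemma augmentation_surjective:
  assumes vertices: "\<And>v. v \<in> V \<Longrightarrow> {v} \<in> \<Delta>"
  shows "augmentation ` (face_chains \<Delta> 0 :: ('n, 'k::comm_ring_1) chain set)
    = ideal_gen (mon_poly ` V)"
proof (rule antisym)
  show "augmentation ` face_chains \<Delta> 0 \<subseteq> (ideal_gen (mon_poly ` V) :: ('n, 'k) mpol set)"
    using augmentation_linear by (auto simp: linear_map_on_def)
  show "(ideal_gen (mon_poly ` V) :: ('n, 'k) mpol set) \<subseteq> augmentation ` face_chains \<Delta> 0"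
  proof
    interpret R: module "(*) :: ('n, 'k) mpol \<Rightarrow> _" by (rule module_mult)
    fix p :: "('n, 'k) mpol" assume "p \<in> ideal_gen (mon_poly ` V)"
    then have "p \<in> range (\<lambda>a. \<Sum>x\<in>mon_poly ` V. a x * x)"
      unfolding ideal_gen_def using R.span_finite[of "mon_poly ` V"] finite_V by blast
    then obtain a where "p = (\<Sum>x\<in>mon_poly ` V. a x * x)" by blast
    also have "\<dots> = (\<Sum>v\<in>V. a (mon_poly v) * mon_poly v)"
    proof -
      have "inj_on (mon_poly :: _ \<Rightarrow> ('n, 'k) mpol) V"
        unfolding mon_poly_def
        by (rule inj_onI) (metis lookup_single_eq lookup_single_not_eq one_neq_zero)
      then show ?thesis by (simp add: sum.reindex)
    qed
    finally have p: "p = (\<Sum>v\<in>V. a (mon_poly v) * mon_poly v)" .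
    let ?c = "\<Sum>v\<in>V. Poly_Mapping.single {v} (a (mon_poly v))"
    have look: "Poly_Mapping.lookup ?c F = (\<Sum>v\<in>V. if F = {v} then a (mon_poly v) else 0)" for F
      by (auto simp: lookup_sum lookup_single when_def intro!: sum.cong)
    have c: "?c \<in> face_chains \<Delta> 0"
    proof (rule face_chainsI)
      fix F assume "Poly_Mapping.lookup ?c F \<noteq> 0"
      then have "\<not> (\<forall>v\<in>V. F \<noteq> {v})"
        unfolding look by (rule contrapos_nn) (auto intro!: sum.neutral)
      then obtain v where "v \<in> V" "F = {v}" by blast
      then show "F \<in> \<Delta> \<and> card F = Suc 0" using vertices by simp
    qed
    have "augmentation ?c = p"
    proof -
      have "Poly_Mapping.lookup ?c {v} = a (mon_poly v)" if "v \<in> V" for v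
        unfolding look using that finite_V by simp
      then show ?thesis unfolding augmentation_chain[OF c] p by (intro sum.cong) simp_all
    qed
    then show "p \<in> augmentation ` face_chains \<Delta> 0" using c by blast
  qed
qed

text \<open>
  The reduced homology with coefficients in \<open>'k\<close> of the faces whose label divides \<open>m\<close>
  vanishes in every nonnegative dimension, for every \<open>m\<close>. Degree \<open>-1\<close> is left out: for
  a monomial \<open>m\<close> outside the ideal, only the empty face has a label dividing \<open>m\<close>. The
  argument only serves to name the type of the coefficients.
\<close>
definition acyclic_below :: "'k::comm_ring_1 itself \<Rightarrow> bool" where
  "acyclic_below (t :: 'k itself) \<longleftrightarrow> (\<forall>m j (\<phi> :: 'n mon set \<Rightarrow> 'k).
     (\<forall>F. \<phi> F \<noteq> 0 \<longrightarrow> F \<in> \<Delta> \<and> mlcm F \<le> m \<and> card F = Suc j) \<longrightarrow>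
     (\<forall>G\<subseteq>V. bd \<phi> G = 0) \<longrightarrow>
     (\<exists>\<psi>. (\<forall>F. \<psi> F \<noteq> 0 \<longrightarrow> F \<in> \<Delta> \<and> mlcm F \<le> m \<and> card F = Suc (Suc j)) \<and> (\<forall>G\<subseteq>V. bd \<psi> G = \<phi> G)))"

text \<open>
  Each strand of \<open>z\<close> bounds within its degree. A zero strand gets the zero chain, so that only
  finitely many degrees contribute and the bounding chains assemble to one with polynomial coefficients.
\<close>
lemma lift_strands:
  fixes z :: "('n, 'k::comm_ring_1) chain"
  assumes acyclic: "acyclic_below TYPE('k)"
    and z: "z \<in> face_chains \<Delta> j"
    and cycle: "\<And>m G. G \<subseteq> V \<Longrightarrow> bd (strand m z) G = 0"
  shows "z \<in> boundary r ` face_chains \<Delta> (Suc j)"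
proof -
  define fills where "fills m \<psi> \<longleftrightarrow>
      (\<forall>F. \<psi> F \<noteq> 0 \<longrightarrow> F \<in> \<Delta> \<and> mlcm F \<le> m \<and> card F = Suc (Suc j)) \<and>
      (\<forall>G\<subseteq>V. bd \<psi> G = strand m z G) \<and>
      ((\<forall>F. strand m z F = 0) \<longrightarrow> (\<forall>F. \<psi> F = 0))" for m and \<psi> :: "'n mon set \<Rightarrow> 'k"
  have "\<exists>\<psi>. fills m \<psi>" for m
  proof (cases "\<forall>F. strand m z F = 0")
    case True
    then have "fills m (\<lambda>_. 0)" by (simp add: fills_def bd_def)
    then show ?thesis by blast
  next
    case False
    have supp: "F \<in> \<Delta> \<and> mlcm F \<le> m \<and> card F = Suc j" if "strand m z F \<noteq> 0" for F
      using strand_nonzero[OF that] z by (auto simp: face_chains_def)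
    have "\<exists>\<psi>. (\<forall>F. \<psi> F \<noteq> 0 \<longrightarrow> F \<in> \<Delta> \<and> mlcm F \<le> m \<and> card F = Suc (Suc j)) \<and>
        (\<forall>G\<subseteq>V. bd \<psi> G = strand m z G)"
      by (rule acyclic[unfolded acyclic_below_def, rule_format]) (fact supp cycle)+
    then show ?thesis using False by (auto simp: fills_def)
  qed
  then have "\<exists>\<psi>. \<forall>m. fills m (\<psi> m)" by (intro choice allI)
  then obtain \<psi> where "\<forall>m. fills m (\<psi> m)" ..
  then have \<psi>: "\<psi> m F \<noteq> 0 \<Longrightarrow> F \<in> \<Delta> \<and> mlcm F \<le> m \<and> card F = Suc (Suc j)"
      "G \<subseteq> V \<Longrightarrow> bd (\<psi> m) G = strand m z G"
      "\<psi> m F \<noteq> 0 \<Longrightarrow> \<exists>F. strand m z F \<noteq> 0" for m F G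
    unfolding fills_def by blast+
  have "(\<exists>F. strand m z F \<noteq> 0) \<and> F \<subseteq> V" if nz: "\<psi> m F \<noteq> 0" for m F
    using \<psi>(3)[OF nz] \<psi>(1)[OF nz] faces by blast
  then have "{(m, F). \<psi> m F \<noteq> 0} \<subseteq> {m. \<exists>F. strand m z F \<noteq> 0} \<times> Pow V" by auto
  then have "finite {(m, F). \<psi> m F \<noteq> 0}"
    by (rule finite_subset) (intro finite_cartesian_product finite_strands, simp add: finite_V)
  then obtain w where w: "\<And>m. strand m w = \<psi> m"
    using chain_of_strands[of \<psi>] \<psi>(1) by blast
  have wC: "w \<in> face_chains \<Delta> (Suc j)"
    using \<psi>(1) by (auto simp: face_chains_def keys_eq_strand w)
  have "boundary r w = z"
  proof (rule strand_eqI)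
    fix m G
    have "strand m (boundary r w) G = bd (\<psi> m) G"
      using strand_boundary[OF ordered_vertices_axioms keys_face_chains[OF wC]] w by simp
    also have "\<dots> = strand m z G"
    proof (cases "G \<subseteq> V")
      case False
      then have "strand m z G = 0" using strand_nonzero keys_face_chains[OF z] by blast
      moreover have "bd (\<psi> m) G = 0"
      proof (rule ccontr)
        assume "bd (\<psi> m) G \<noteq> 0"
        then obtain v where "\<psi> m (insert v G) \<noteq> 0" by (rule bd_nonzero)
        then have "insert v G \<subseteq> V" using \<psi>(1) faces by blast
        then show False using False by blast
      qed
      ultimately show ?thesis by simp
    qed (rule \<psi>(2))
    finally show "strand m (boundary r w) G = strand m z G" .
  qed
  then show ?thesis using wC by blast
qed

lemma boundary_boundary:
  fixes c :: "('n, 'k::comm_ring_1) chain"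
  assumes c: "c \<in> face_chains \<Delta> (Suc (Suc i))"
  shows "boundary r (boundary r c) = 0"
proof (rule strand_eqI)
  fix m G
  have bc: "boundary r c \<in> face_chains \<Delta> (Suc i)"
    by (rule boundary_mem[OF c])
  then have bbc: "boundary r (boundary r c) \<in> face_chains \<Delta> i"
    by (rule boundary_mem)
  show "strand m (boundary r (boundary r c)) G = strand m 0 G"
  proof (cases "G \<subseteq> V")
    case True
    then show ?thesis
      by (simp add: strand_boundary[OF ordered_vertices_axioms keys_face_chains[OF bc]]
          strand_boundary[OF ordered_vertices_axioms keys_face_chains[OF c]] bd_bd)
  next
    case False
    then show ?thesis using strand_nonzero keys_face_chains[OF bbc] by fastforce
  qed
qed

lemma augmentation_boundary:
  fixes c :: "('n, 'k::comm_ring_1) chain"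
  assumes c: "c \<in> face_chains \<Delta> (Suc 0)"
  shows "augmentation (boundary r c) = 0"
proof (rule poly_mapping_eqI)
  fix m
  have "boundary r c \<in> face_chains \<Delta> 0"
    by (rule boundary_mem[OF c])
  then have "Poly_Mapping.keys (boundary r c) \<subseteq> {F. F \<subseteq> V \<and> card F = 1}"
    using faces by (auto simp: face_chains_def)
  then show "Poly_Mapping.lookup (augmentation (boundary r c)) m = Poly_Mapping.lookup 0 m"
    using keys_face_chains[OF c]
    by (simp add: lookup_augmentation[OF ordered_vertices_axioms]
        strand_boundary[OF ordered_vertices_axioms] bd_bd)
qed

text \<open>
  The criterion of Bayer, Peeva and Sturmfels for a simplicial complex to support a resolution.
\<close>
lemma free_resolution_if_acyclic:
  assumes acyclic: "acyclic_below TYPE('k::comm_ring_1)"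
    and vertices: "\<And>v. v \<in> V \<Longrightarrow> {v} \<in> \<Delta>"
  shows "free_resolution chain_scale (face_chains \<Delta>) (\<lambda>_. boundary r) augmentation
    (ideal_gen (mon_poly ` V) :: ('n, 'k) mpol set)"
  unfolding free_resolution_def
proof (intro conjI allI)
  let ?C = "\<lambda>i. face_chains \<Delta> i :: ('n, 'k) chain set"
  have into: "boundary r c \<in> ?C i" if "c \<in> ?C (Suc i)" for c i
    by (rule boundary_mem[OF that])
  show "{c \<in> ?C 0. augmentation c = 0} = boundary r ` ?C 1"
  proof (intro antisym subsetI)
    fix z assume z: "z \<in> {c \<in> ?C 0. augmentation c = 0}"
    have "bd (strand m z) G = 0" for m G
    proof (cases "G = {}")
      case True
      have "Poly_Mapping.keys z \<subseteq> {F. F \<subseteq> V \<and> card F = 1}"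
        using z faces by (auto simp: face_chains_def)
      from lookup_augmentation[OF ordered_vertices_axioms this, of m] z True show ?thesis by simp
    next
      case False
      show ?thesis
      proof (rule ccontr)
        assume "bd (strand m z) G \<noteq> 0"
        then obtain v where v: "v \<in> V - G" "strand m z (insert v G) \<noteq> 0" using bd_nonzero by blast
        then have "card (insert v G) = Suc 0" using z strand_nonzero by (fastforce simp: face_chains_def)
        then show False using v(1) False by (auto simp: card_1_singleton_iff)
      qed
    qed
    then show "z \<in> boundary r ` ?C 1" using lift_strands[OF acyclic, of z 0] z by simp
  qed (use into augmentation_boundary in auto)
  show "{c \<in> ?C (Suc i). boundary r c = 0} = boundary r ` ?C (Suc (Suc i))" for i
  proof (intro antisym subsetI)
    fix z assume z: "z \<in> {c \<in> ?C (Suc i). boundary r c = 0}"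
    then have zC: "z \<in> ?C (Suc i)" by simp
    have "bd (strand m z) G = 0" for m G
      using z by (simp flip: strand_boundary[OF ordered_vertices_axioms keys_face_chains[OF zC]])
    then show "z \<in> boundary r ` ?C (Suc (Suc i))" using lift_strands[OF acyclic zC] by simp
  qed (use into boundary_boundary in auto)
qed (use module_chain_scale free_submodule_face_chains boundary_linear augmentation_linear
    augmentation_surjective[OF vertices] in auto)

end

section \<open>Minimality of the differentials\<close>

lemma mon_poly_irrelevant_iff:
  "(mon_poly a :: ('n, 'k::comm_ring_1) mpol) \<in> irrelevant_ideal \<longleftrightarrow> a \<noteq> 0"
proof -
  have var: "range var = (mon_poly ` range (\<lambda>i. 0(i := 1)) :: ('n, 'k) mpol set)"
    by (auto simp: var_def)
  have "(\<exists>b\<in>range (\<lambda>i. 0(i := 1)). b \<le> a) \<longleftrightarrow> (\<exists>i. 1 \<le> a i)"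
    by (auto simp: le_fun_def)
  also have "\<dots> \<longleftrightarrow> a \<noteq> 0" by (auto simp: fun_eq_iff Suc_le_eq)
  finally show ?thesis unfolding irrelevant_ideal_def var mon_poly_mem_ideal_gen_iff .
qed

lemma lookup_ideal_times:
  fixes c :: "('n, 'k::comm_ring_1) chain"
  assumes "c \<in> ideal_times chain_scale irrelevant_ideal C"
  shows "Poly_Mapping.lookup c F \<in> irrelevant_ideal"
proof -
  interpret R: module "(*) :: ('n, 'k) mpol \<Rightarrow> _" by (rule module_mult)
  interpret M: module "chain_scale :: ('n, 'k) mpol \<Rightarrow> _" by (rule module_chain_scale)
  have irr: "R.subspace (irrelevant_ideal :: ('n, 'k) mpol set)"
    by (simp add: irrelevant_ideal_def ideal_gen_def)
  let ?D = "{d :: ('n, 'k) chain. Poly_Mapping.lookup d F \<in> irrelevant_ideal}"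
  have "M.subspace ?D"
  proof (rule M.subspaceI)
    show "0 \<in> ?D" using R.subspace_0[OF irr] by simp
    show "d + e \<in> ?D" if "d \<in> ?D" "e \<in> ?D" for d e
      using R.subspace_add[OF irr] that by (simp add: lookup_add)
    show "chain_scale p d \<in> ?D" if "d \<in> ?D" for p d
      using R.subspace_scale[OF irr] that by simp
  qed
  moreover have "{chain_scale a x |a x. a \<in> irrelevant_ideal \<and> x \<in> C} \<subseteq> ?D"
  proof clarify
    fix a :: "('n, 'k) mpol" and x assume a: "a \<in> irrelevant_ideal"
    show "Poly_Mapping.lookup (chain_scale a x) F \<in> irrelevant_ideal"
      using R.subspace_scale[OF irr a, of "Poly_Mapping.lookup x F"] by (simp add: mult.commute)
  qed
  ultimately show ?thesis
    using assms M.span_minimal[of _ ?D] unfolding ideal_times_def by blast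
qed

context labeled_complex
begin

text \<open>
  Facets with smaller labels have nonconstant monomials as coefficients.
\<close>
lemma boundary_minimal:
  fixes c :: "('n, 'k::comm_ring_1) chain"
  assumes labels: "\<And>F v. F \<in> \<Delta> \<Longrightarrow> v \<in> F \<Longrightarrow> mlcm (F - {v}) \<noteq> mlcm F"
    and c: "c \<in> face_chains \<Delta> (Suc i)"
  shows "boundary r c \<in> ideal_times chain_scale irrelevant_ideal (face_chains \<Delta> i)"
proof -
  interpret module "chain_scale :: ('n, 'k) mpol \<Rightarrow> _" by (rule module_chain_scale)
  show ?thesis
    unfolding boundary_def face_boundary_alt scale_sum_right ideal_times_def
  proof (intro span_sum span_base CollectI)
    fix F v assume F: "F \<in> Poly_Mapping.keys c" and v: "v \<in> F"
    have F\<Delta>: "F \<in> \<Delta>" "card F = Suc (Suc i)" using c F by (auto simp: face_chains_def)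
    then have fin: "finite F" using card.infinite by fastforce
    let ?a = "mlcm F - mlcm (F - {v})" and ?p = "Poly_Mapping.lookup c F"
    let ?x = "Poly_Mapping.single (F - {v}) (?p * vsign r v F) :: ('n, 'k) chain"
    have "?a \<noteq> 0"
    proof
      assume "?a = 0"
      then have "mlcm F \<le> mlcm (F - {v})" by (simp add: fun_eq_iff le_fun_def)
      then show False using labels[OF F\<Delta>(1) v] mlcm_mono[OF fin, of "F - {v}"] by simp
    qed
    then have "mon_poly ?a \<in> (irrelevant_ideal :: ('n, 'k) mpol set)"
      by (simp add: mon_poly_irrelevant_iff)
    moreover have "?x \<in> face_chains \<Delta> i"
      using F\<Delta> v fin down by (intro face_chainsI) (auto simp: lookup_single when_def split: if_splits)
    ultimately show "\<exists>a x. chain_scale ?p (Poly_Mapping.single (F - {v}) (vsign r v F * mon_poly ?a))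
        = chain_scale a x \<and> a \<in> irrelevant_ideal \<and> x \<in> face_chains \<Delta> i"
      by (intro exI[of _ "mon_poly ?a"] exI[of _ ?x]) (simp add: mult_ac)
  qed
qed

text \<open>
  If the labels agree, the boundary of the generator of \<open>F\<close> has a unit as coefficient at \<open>F -
  {v}\<close>.
\<close>
lemma labels_differ_if_minimal:
  assumes minimal: "boundary r ` face_chains \<Delta> (Suc i)
      \<subseteq> ideal_times chain_scale irrelevant_ideal (face_chains \<Delta> i :: ('n, 'k::comm_ring_1) chain set)"
    and F: "F \<in> \<Delta>" "card F = Suc (Suc i)" and v: "v \<in> F"
  shows "mlcm (F - {v}) \<noteq> mlcm F"
proof
  assume eq: "mlcm (F - {v}) = mlcm F"
  interpret R: module "(*) :: ('n, 'k) mpol \<Rightarrow> _" by (rule module_mult)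
  let ?c = "Poly_Mapping.single F 1 :: ('n, 'k) chain"
  have c: "?c \<in> face_chains \<Delta> (Suc i)"
    using F by (intro face_chainsI) (auto simp: lookup_single when_def split: if_splits)
  have ins: "insert w (F - {v}) = F \<longleftrightarrow> w = v" if "w \<in> V - (F - {v})" for w
    using that v by blast
  have "Poly_Mapping.lookup (boundary r ?c) (F - {v})
      = (\<Sum>w\<in>V - (F - {v}). if w = v then vsign r v F * mon_poly 0 else 0)"
    unfolding lookup_boundary[OF finite_V keys_face_chains[OF c]]
  proof (rule sum.cong)
    fix w assume w: "w \<in> V - (F - {v})"
    show "vsign r w (F - {v}) * (Poly_Mapping.lookup ?c (insert w (F - {v}))
          * mon_poly (mlcm (insert w (F - {v})) - mlcm (F - {v})))
        = (if w = v then vsign r v F * mon_poly 0 else 0)"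
    proof (cases "w = v")
      case True
      have "insert v (F - {v}) = F" using v by blast
      then show ?thesis by (simp only: True eq vsign_remove_self lookup_single_eq mult_1 simp_thms if_True
            cancel_comm_monoid_add_class.diff_cancel)
    next
      case False
      then have "F \<noteq> insert w (F - {v})" using ins[OF w] by blast
      then show ?thesis using False by (simp only: lookup_single_not_eq[OF \<open>F \<noteq> insert w (F - {v})\<close>] mult_zero_left mult_zero_right if_False)
    qed
  qed simp
  also have "\<dots> = vsign r v F * mon_poly 0"
    using v faces[OF F(1)] finite_V by (subst sum.delta) auto
  finally have coeff: "Poly_Mapping.lookup (boundary r ?c) (F - {v}) = vsign r v F * mon_poly 0" .
  have "boundary r ?c \<in> ideal_times chain_scale irrelevant_ideal (face_chains \<Delta> i)"
    using minimal c by blast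
  then have "vsign r v F * mon_poly 0 \<in> (irrelevant_ideal :: ('n, 'k) mpol set)"
    using lookup_ideal_times[of "boundary r ?c" _ "F - {v}"] unfolding coeff by blast
  then have "vsign r v F * (vsign r v F * mon_poly 0) \<in> (irrelevant_ideal :: ('n, 'k) mpol set)"
    unfolding irrelevant_ideal_def ideal_gen_def by (rule R.span_scale)
  then show False by (simp only: vsign_square mon_poly_irrelevant_iff)
qed

end

section \<open>The Buchberger and Scarf complexes\<close>

lemma zero_notin_min_gens:
  fixes I :: "('n::finite, 'k::comm_ring_1) mpol set"
  assumes "monomial_ideal I" "I \<noteq> UNIV"
  shows "0 \<notin> min_gens I"
proof
  interpret R: module "(*) :: ('n, 'k) mpol \<Rightarrow> _" by (rule module_mult)
  assume "0 \<in> min_gens I"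
  then have "p * mon_poly 0 \<in> ideal_gen (mon_poly ` min_gens I)" for p :: "('n, 'k) mpol"
    unfolding ideal_gen_def by (intro R.span_scale R.span_base imageI)
  then have "p * mon_poly 0 \<in> I" for p :: "('n, 'k) mpol"
    by (simp only: ideal_gen_min_gens[OF assms(1)])
  then have "p \<in> I" for p :: "('n, 'k) mpol"
    unfolding mon_poly_def single_one mult_1_right .
  then show False using assms(2) by blast
qed

context
  fixes I :: "('n::finite, 'k::comm_ring_1) mpol set"
begin

lemma finite_gens: "F \<subseteq> min_gens I \<Longrightarrow> finite F"
  using finite_min_gens finite_subset by blast

lemma buchberger_down:
  assumes "F \<in> buchberger_complex I" "G \<subseteq> F"
  shows "G \<in> buchberger_complex I"
proof -
  have F: "F \<subseteq> min_gens I" "\<And>u. u \<in> min_gens I \<Longrightarrow> \<not> properly_divides u (mlcm F)"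
    using assms(1) by (auto simp: buchberger_complex_def)
  have "mlcm G \<le> mlcm F" using mlcm_mono[OF finite_gens[OF F(1)] assms(2)] .
  then have "\<not> properly_divides u (mlcm G)" if "u \<in> min_gens I" for u
    using F(2)[OF that] properly_divides_mono by blast
  then show ?thesis using F(1) assms(2) by (auto simp: buchberger_complex_def)
qed

lemma buchberger_vertex:
  assumes proper: "0 \<notin> min_gens I" and v: "v \<in> min_gens I"
  shows "{v} \<in> buchberger_complex I"
proof -
  have "\<not> properly_divides u v" if u: "u \<in> min_gens I" for u
  proof
    assume pd: "properly_divides u v"
    then have "u = v" using u v properly_divides_le[OF pd] unfolding min_gens_def by blast
    then have "u = 0" using pd properly_divides_self by blast
    then show False using u proper by blast
  qed
  then show ?thesis using v by (simp add: buchberger_complex_def)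
qed

text \<open>
  If \<open>u\<close> properly divides the label of \<open>F\<close>, then \<open>insert u F\<close> and
  \<open>F - {u}\<close> both have this label, and they cannot both equal \<open>F\<close>.
\<close>
lemma scarf_subset_buchberger: "scarf_complex I \<subseteq> buchberger_complex I"
proof
  fix F assume F: "F \<in> scarf_complex I"
  then have sub: "F \<subseteq> min_gens I"
    and unique: "\<And>G. G \<subseteq> min_gens I \<Longrightarrow> mlcm F = mlcm G \<Longrightarrow> F = G"
    by (auto simp: scarf_complex_def)
  have "\<not> properly_divides u (mlcm F)" if u: "u \<in> min_gens I" for u
  proof
    assume pd: "properly_divides u (mlcm F)"
    have "F = insert u F"
      by (rule unique)
        (use sub u mlcm_insert_absorb[OF finite_gens[OF sub] properly_divides_le[OF pd]] in auto)
    moreover have "F = F - {u}"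
      by (rule unique) (use sub mlcm_remove_properly_dividing[OF finite_gens[OF sub] pd] in auto)
    ultimately show False by blast
  qed
  then show "F \<in> buchberger_complex I" using sub by (auto simp: buchberger_complex_def)
qed

lemma labeled_complex_buchberger:
  assumes "linear_order_on (min_gens I) r"
  shows "labeled_complex (min_gens I) r (buchberger_complex I)"
proof
  show "F \<subseteq> min_gens I" if "F \<in> buchberger_complex I" for F
    using that by (simp add: buchberger_complex_def)
qed (fact finite_min_gens assms buchberger_down)+

text \<open>
  The matching adds or removes a generator that properly divides the label. It is chosen as a function of the
  label alone and the rank is the total degree of the label: for nested sets, equal rank then forces equal
  labels and hence the same generator. A nonzero chain of nonempty faces supplies the apex needed to contract
  the simplex of all generators dividing \<open>m\<close>.
\<close>
lemma buchberger_acyclic: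
  assumes r: "linear_order_on (min_gens I) r"
  shows "labeled_complex.acyclic_below (min_gens I) r (buchberger_complex I) TYPE('k)"
proof -
  interpret labeled_complex "min_gens I" r "buchberger_complex I"
    using labeled_complex_buchberger[OF r] .
  define B where "B = {F. F \<subseteq> min_gens I \<and> (\<exists>u\<in>min_gens I. properly_divides u (mlcm F))}"
  define u where "u F = (SOME u. u \<in> min_gens I \<and> properly_divides u (mlcm F))" for F
  define rank where "rank F = (\<Sum>i\<in>UNIV. mlcm F i)" for F :: "'n mon set"
  have u: "F \<subseteq> min_gens I" "finite F" "u F \<in> min_gens I" "properly_divides (u F) (mlcm F)" if "F \<in> B" for F
    using that finite_gens someI_ex[of "\<lambda>u. u \<in> min_gens I \<and> properly_divides u (mlcm F)"]
    by (auto simp: B_def u_def)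
  have ins: "mlcm (insert (u F) F) = mlcm F" and rem: "mlcm (F - {u F}) = mlcm F" if "F \<in> B" for F
    using u[OF that] mlcm_insert_absorb mlcm_remove_properly_dividing properly_divides_le by blast+
  interpret nonface_matching "min_gens I" r B u rank
  proof
    fix F assume F: "F \<in> B"
    show "F \<subseteq> min_gens I \<and> u F \<in> min_gens I \<and> insert (u F) F \<in> B \<and> F - {u F} \<in> B"
      using u[OF F] ins[OF F] rem[OF F] by (auto simp: B_def)
    show "rank (insert (u F) F) = rank F \<and> rank (F - {u F}) = rank F"
      using ins[OF F] rem[OF F] by (simp add: rank_def)
    fix F' assume F': "F \<subseteq> F'" "F' \<subseteq> min_gens I"
    have le: "mlcm F \<le> mlcm F'" using F' finite_gens mlcm_mono by blast
    have "properly_divides (u F) (mlcm F')" by (rule properly_divides_mono[OF u(4)[OF F] le])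
    then show "F' \<in> B" using u(3)[OF F] F'(2) by (auto simp: B_def)
    show "rank F \<le> rank F'" using le by (auto simp: rank_def le_fun_def intro!: sum_mono)
    show "u F' = u F" if "rank F' = rank F"
    proof -
      have "mlcm F' i = mlcm F i" for i
        using that le sum_strict_mono_ex1[of UNIV "mlcm F" "mlcm F'"]
        by (metis UNIV_I finite_UNIV le_fun_def less_irrefl order_le_imp_less_or_eq rank_def)
      then have "mlcm F' = mlcm F" by blast
      then show ?thesis by (simp add: u_def)
    qed
  qed
  show ?thesis
    unfolding acyclic_below_def
  proof (intro allI impI)
    fix m j and \<phi> :: "'n mon set \<Rightarrow> 'k"
    assume \<phi>: "\<forall>F. \<phi> F \<noteq> 0 \<longrightarrow> F \<in> buchberger_complex I \<and> mlcm F \<le> m \<and> card F = Suc j"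
      and cycle: "\<forall>G\<subseteq>min_gens I. bd \<phi> G = 0"
    define X where "X = {F. F \<subseteq> min_gens I \<and> mlcm F \<le> m}"
    have X_iff: "F \<in> X \<longleftrightarrow> F \<subseteq> {v \<in> min_gens I. v \<le> m}" for F
    proof (cases "F \<subseteq> min_gens I")
      case True
      then show ?thesis using mlcm_le_iff[OF finite_gens[OF True]] by (auto simp: X_def)
    qed (auto simp: X_def)
    have XB: "F \<in> X - B \<longleftrightarrow> F \<in> buchberger_complex I \<and> mlcm F \<le> m" for F
      by (auto simp: X_def B_def buchberger_complex_def)
    show "\<exists>\<psi>. (\<forall>F. \<psi> F \<noteq> 0 \<longrightarrow> F \<in> buchberger_complex I \<and> mlcm F \<le> m \<and> card F = Suc (Suc j)) \<and>
        (\<forall>G\<subseteq>min_gens I. bd \<psi> G = \<phi> G)"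
    proof (cases "\<exists>F. \<phi> F \<noteq> 0")
      case False
      then show ?thesis by (intro exI[of _ "\<lambda>_. 0"]) (simp add: bd_def)
    next
      case True
      then obtain F where F: "F \<in> X" "card F = Suc j" using \<phi> XB by blast
      then obtain x where "x \<in> F" by (metis card_eq_0_iff ex_in_conv nat.distinct(1))
      then have x: "x \<in> min_gens I" "x \<le> m" using F(1) by (auto simp: X_iff)
      have "\<exists>\<psi>. (\<forall>F. \<psi> F \<noteq> 0 \<longrightarrow> F \<in> X - B \<and> card F = Suc (Suc j)) \<and>
          (\<forall>G\<subseteq>min_gens I. bd \<psi> G = \<phi> G)"
      proof (rule cycle_is_boundary[OF _ _ _ x(1)])
        show "insert (u F) F \<in> X" if "F \<in> X" "F \<in> B" for F
          using that ins u by (simp add: X_def)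
      qed (use \<phi> XB cycle x in \<open>auto simp: X_iff\<close>)
      then show ?thesis by (simp only: XB conj_assoc)
    qed
  qed
qed

text \<open>
  If a Buchberger face \<open>F\<close> and \<open>G\<close> share a label, adding a vertex of \<open>G\<close>
  to \<open>F\<close> gives a Buchberger face with the same label. By the hypothesis it is no larger than
  \<open>F\<close>, so \<open>G \<subseteq> F\<close>, and by symmetry \<open>F = G\<close>. The restriction to
  faces with at least two vertices, which is what the differentials can detect, is harmless: the label of the
  empty face is \<open>0\<close>, and no generator divides it.
\<close>
lemma buchberger_subset_scarf:
  assumes proper: "0 \<notin> min_gens I"
    and labels: "\<And>F v. F \<in> buchberger_complex I \<Longrightarrow> 2 \<le> card F \<Longrightarrow> v \<in> F \<Longrightarrow> mlcm (F - {v}) \<noteq> mlcm F"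
  shows "buchberger_complex I \<subseteq> scarf_complex I"
proof
  have absorb: "G \<subseteq> F" if F: "F \<in> buchberger_complex I" and G: "G \<subseteq> min_gens I" and eq: "mlcm F = mlcm G" for F G
  proof
    fix v assume v: "v \<in> G"
    have sub: "F \<subseteq> min_gens I" using F by (auto simp: buchberger_complex_def)
    show "v \<in> F"
    proof (rule ccontr)
      assume "v \<notin> F"
      have fin: "finite F" "finite G" using sub G finite_gens by auto
      have v_le: "v \<le> mlcm F" using mlcm_upper[OF fin(2) v] eq by simp
      have lab: "mlcm (insert v F) = mlcm F" using mlcm_insert_absorb[OF fin(1) v_le] .
      have "insert v F \<in> buchberger_complex I"
        using F G v lab by (auto simp: buchberger_complex_def)
      moreover have "F \<noteq> {}"
      proof
        assume "F = {}"
        then have "v = 0" using v_le by (auto simp: le_fun_def fun_eq_iff)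
        then show False using proper G v by blast
      qed
      then have "2 \<le> card (insert v F)"
        using fin(1) \<open>v \<notin> F\<close> by (simp add: Suc_le_eq card_gt_0_iff)
      ultimately have "mlcm (insert v F - {v}) \<noteq> mlcm (insert v F)" by (intro labels) auto
      then show False using lab \<open>v \<notin> F\<close> by simp
    qed
  qed
  fix F assume F: "F \<in> buchberger_complex I"
  then have sub: "F \<subseteq> min_gens I" by (simp add: buchberger_complex_def)
  have "F = G" if G: "G \<subseteq> min_gens I" "mlcm F = mlcm G" for G
  proof (rule antisym)
    have "G \<in> buchberger_complex I" using F G by (auto simp: buchberger_complex_def)
    then show "F \<subseteq> G" by (rule absorb[OF _ sub G(2)[symmetric]])
  qed (rule absorb[OF F G])
  then show "F \<in> scarf_complex I" using sub unfolding scarf_complex_def by blast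
qed

end

theorem proposition2p3:
  fixes I :: "('n::finite, 'k::field) mpol set"
    and r :: "'n mon rel"
  assumes "monomial_ideal I"
    and "I \<noteq> UNIV"
    and "linear_order_on (min_gens I) r"
  shows "minimal_resolution_by_complex r (buchberger_complex I) I
     \<longleftrightarrow> scarf_complex I = buchberger_complex I"
proof -
  have proper: "0 \<notin> min_gens I" using zero_notin_min_gens assms(1,2) .
  interpret labeled_complex "min_gens I" r "buchberger_complex I"
    using labeled_complex_buchberger[OF assms(3)] .
  show ?thesis
  proof
    assume "minimal_resolution_by_complex r (buchberger_complex I) I"
    then have minimal: "boundary r ` face_chains (buchberger_complex I) (Suc i)
        \<subseteq> ideal_times chain_scale irrelevant_ideal
            (face_chains (buchberger_complex I) i :: ('n, 'k) chain set)" for i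
      by (simp add: minimal_resolution_by_complex_def minimal_free_resolution_def)
    have "mlcm (F - {v}) \<noteq> mlcm F" if "F \<in> buchberger_complex I" "2 \<le> card F" "v \<in> F" for F v
    proof -
      have "card F = Suc (Suc (card F - 2))" using that(2) by simp
      from labels_differ_if_minimal[OF minimal that(1) this that(3)] show ?thesis .
    qed
    from buchberger_subset_scarf[OF proper this] scarf_subset_buchberger
    show "scarf_complex I = buchberger_complex I" by blast
  next
    assume eq: "scarf_complex I = buchberger_complex I"
    have labels: "mlcm (F - {v}) \<noteq> mlcm F" if "F \<in> buchberger_complex I" "v \<in> F" for F v
    proof
      assume "mlcm (F - {v}) = mlcm F"
      moreover have "F \<subseteq> min_gens I" "\<And>G. G \<subseteq> min_gens I \<Longrightarrow> mlcm F = mlcm G \<Longrightarrow> F = G"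
        using that(1) unfolding eq[symmetric] scarf_complex_def by blast+
      ultimately have "F = F - {v}" by (metis Diff_subset subset_trans)
      then show False using that(2) by blast
    qed
    have "free_resolution chain_scale (face_chains (buchberger_complex I)) (\<lambda>_. boundary r) augmentation I"
      using free_resolution_if_acyclic[OF buchberger_acyclic[OF assms(3)] buchberger_vertex[OF proper]]
      by (simp add: ideal_gen_min_gens[OF assms(1)])
    then show "minimal_resolution_by_complex r (buchberger_complex I) I"
      unfolding minimal_resolution_by_complex_def minimal_free_resolution_def
      using boundary_minimal[OF labels] by blast
  qed
qed

end
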